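(* Let $N\ge 2$, let $(D_j,d_j)$, $1\le j\le N$, be nonempty compact metric spaces, let $\mu_j$ be a finite Borel measure on $D_j$ with $\mu_1(D_1)=\mu_j(D_j)$ for $2\le j\le N$, and let $c:D_1\times\cdots\times D_N\to\mathbb{R}$ be Lipschitz. Suppose $\mu_1(G)>0$ for each nonempty open set $G\subset D_1$ and $c$ satisfies the single-valued a.e. condition SV. Then the mapping minimizing $$\int_{D_1}c\big(x_1,s(x_1)\big)\,d\mu_1(x_1)$$ over all measure preserving maps $s\in\mathcal S$ is unique up to $\mu_1$-null sets: any two minimizers $s,s'\in\mathcal S$ satisfy $s(x_1)=s'(x_1)$ for $\mu_1$-a.e. $x_1\in D_1$.
   Context: Lipschitz means: there is $K>0$ with $|c(x_1,\dots,x_N)-c(y_1,\dots,y_N)|\le K\,(d_1(x_1,y_1)+\cdots+d_N(x_N,y_N))$ for all $x_i,y_i\in D_i$. $c$-transform: for $F=(f_1,\dots,f_N)\in C(D_1)\times\cdots\times C(D_N)$ (real-valued continuous functions), the $j$-th $c$-transform of $F$ is $$f_j^c(x_j)=\inf_{z_k\in D_k,\,k\ne j}\Big\{c(z_1,\dots,z_{j-1},x_j,z_{j+1},\dots,z_N)-\sum_{k\ne j}f_k(z_k)\Big\}.$$ The vector $(f_1,\dots,f_N)$ is $c$-conjugate if $f_j=f_j^c$ for all $1\le j\le N$. $c$-normal mapping: for $(f_1,\dots,f_N)$ $c$-conjugate, $\partial_cf_1$ is the multivalued map $$\partial_cf_1(x_1)=\{(z_2,\dots,z_N)\in D_2\times\cdots\times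 D_N: f_1(x_1)+f_2(z_2)+\cdots+f_N(z_N)=c(x_1,z_2,\dots,z_N)\}.$$ Condition SV: for each $c$-conjugate $(f_1,\dots,f_N)\in C(D_1)\times\cdots\times C(D_N)$, the set $\partial_cf_1(x_1)$ is a singleton for $\mu_1$-a.e. $x_1\in D_1$. Measure preserving: for a multivalued map $T:D_1\to D_j$, put $T^{-1}(E)=\{x_1\in D_1:T(x_1)\cap E\ne\emptyset\}$; $T$ is measure preserving $(\mu_1,\mu_j)$ if for every Borel set $E\subset D_j$ the set $T^{-1}(E)$ is $\mu_1$-measurable (measurable for the completion of $\mu_1$) and $\mu_1(T^{-1}(E))=\mu_j(E)$. Class $\mathcal S$: the maps $s$ from $D_1$ to $D_2\times\cdots\times D_N$, possibly multivalued but single-valued for $\mu_1$-a.e. $x_1$, such that, with $P_j$ the projection of $D_2\times\cdots\times D_N$ onto $D_j$, the map $T_j=P_j\circ s$ is measure preserving $(\mu_1,\mu_j)$ for each $2\le j\le N$. In integrals, $s(x_1)$ denotes its unique value, defined for $\mu_1$-a.e. $x_1$. *)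

theory Defs
  imports "HOL-Analysis.Analysis"
begin

text \<open>
  The spaces \<open>D\<^sub>1, \<dots>, D\<^sub>N\<close> are abstract metrics \<open>X 1, \<dots>, X N\<close>, each with its own carrier and its own
  distance. Products are extensional: \<open>D\<^sub>1 \<times> \<dots> \<times> D\<^sub>N\<close> is \<open>prod_space X {1..N}\<close> and
  \<open>D\<^sub>2 \<times> \<dots> \<times> D\<^sub>N\<close> is \<open>prod_space X {2..N}\<close>. The point of the former with first coordinate \<open>x\<close> and
  remaining coordinates \<open>z\<close> is \<open>z(1 := x)\<close>.
\<close>

definition prod_space :: "(nat \<Rightarrow> 'a metric) \<Rightarrow> nat set \<Rightarrow> (nat \<Rightarrow> 'a) set" where
  "prod_space X I = (\<Pi>\<^sub>E i\<in>I. mspace (X i))"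

definition borel_of :: "'a topology \<Rightarrow> 'a measure" where
  "borel_of T = sigma (topspace T) {U. openin T U}"

definition lipschitz_cost :: "nat \<Rightarrow> (nat \<Rightarrow> 'a metric) \<Rightarrow> ((nat \<Rightarrow> 'a) \<Rightarrow> real) \<Rightarrow> bool" where
  "lipschitz_cost N X c \<longleftrightarrow>
    (\<exists>K>0. \<forall>x\<in>prod_space X {1..N}. \<forall>y\<in>prod_space X {1..N}.
      \<bar>c x - c y\<bar> \<le> K * (\<Sum>i=1..N. mdist (X i) (x i) (y i)))"

definition c_transform ::
    "nat \<Rightarrow> (nat \<Rightarrow> 'a metric) \<Rightarrow> ((nat \<Rightarrow> 'a) \<Rightarrow> real) \<Rightarrow> (nat \<Rightarrow> 'a \<Rightarrow> real) \<Rightarrow> nat \<Rightarrow> 'a \<Rightarrow> real" where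
  "c_transform N X c f j x =
    (INF z\<in>prod_space X ({1..N} - {j}). c (z(j := x)) - (\<Sum>k\<in>{1..N} - {j}. f k (z k)))"

definition c_conjugate ::
    "nat \<Rightarrow> (nat \<Rightarrow> 'a metric) \<Rightarrow> ((nat \<Rightarrow> 'a) \<Rightarrow> real) \<Rightarrow> (nat \<Rightarrow> 'a \<Rightarrow> real) \<Rightarrow> bool" where
  "c_conjugate N X c f \<longleftrightarrow> (\<forall>j\<in>{1..N}. \<forall>x\<in>mspace (X j). f j x = c_transform N X c f j x)"

definition c_normal ::
    "nat \<Rightarrow> (nat \<Rightarrow> 'a metric) \<Rightarrow> ((nat \<Rightarrow> 'a) \<Rightarrow> real) \<Rightarrow> (nat \<Rightarrow> 'a \<Rightarrow> real) \<Rightarrow> 'a \<Rightarrow> (nat \<Rightarrow> 'a) set" where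
  "c_normal N X c f x = {z \<in> prod_space X {2..N}. f 1 x + (\<Sum>k=2..N. f k (z k)) = c (z(1 := x))}"

definition condition_SV ::
    "nat \<Rightarrow> (nat \<Rightarrow> 'a metric) \<Rightarrow> ((nat \<Rightarrow> 'a) \<Rightarrow> real) \<Rightarrow> 'a measure \<Rightarrow> bool" where
  "condition_SV N X c \<mu>1 \<longleftrightarrow>
    (\<forall>f. (\<forall>j\<in>{1..N}. continuous_map (mtopology_of (X j)) euclideanreal (f j)) \<and> c_conjugate N X c f
      \<longrightarrow> (AE x in \<mu>1. is_singleton (c_normal N X c f x)))"

definition multi_preimage :: "'a set \<Rightarrow> ('a \<Rightarrow> 'b set) \<Rightarrow> 'b set \<Rightarrow> 'a set" where
  "multi_preimage A T E = {x \<in> A. T x \<inter> E \<noteq> {}}"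

definition measure_preserving :: "'a measure \<Rightarrow> 'b measure \<Rightarrow> ('a \<Rightarrow> 'b set) \<Rightarrow> bool" where
  "measure_preserving \<mu> \<nu> T \<longleftrightarrow>
    (\<forall>E\<in>sets \<nu>. multi_preimage (space \<mu>) T E \<in> sets (completion \<mu>) \<and>
      emeasure (completion \<mu>) (multi_preimage (space \<mu>) T E) = emeasure \<nu> E)"

text \<open>
  A multivalued map is a set-valued function with nonempty values. Its values outside \<open>D\<^sub>1\<close> are
  unconstrained and play no role.
\<close>

definition class_S ::
    "nat \<Rightarrow> (nat \<Rightarrow> 'a metric) \<Rightarrow> (nat \<Rightarrow> 'a measure) \<Rightarrow> ('a \<Rightarrow> (nat \<Rightarrow> 'a) set) set" where
  "class_S N X \<mu> = {s.
    (\<forall>x\<in>mspace (X 1). s x \<noteq> {} \<and> s x \<subseteq> prod_space X {2..N}) \<and>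
    (AE x in \<mu> 1. is_singleton (s x)) \<and>
    (\<forall>j\<in>{2..N}. measure_preserving (\<mu> 1) (\<mu> j) (\<lambda>x. (\<lambda>z. z j) ` s x))}"

text \<open>
  For \<open>s\<close> in \<open>class_S\<close>, the integrand is in general only measurable for the completion of \<open>\<mu>1\<close>. Where
  \<open>s x\<close> is not a singleton, a \<open>\<mu>1\<close>-null set, \<open>the_elem (s x)\<close> is an arbitrary value, which does not
  affect the integral.
\<close>

definition transport_cost ::
    "((nat \<Rightarrow> 'a) \<Rightarrow> real) \<Rightarrow> 'a measure \<Rightarrow> ('a \<Rightarrow> (nat \<Rightarrow> 'a) set) \<Rightarrow> real" where
  "transport_cost c \<mu>1 s = (LINT x|completion \<mu>1. c ((the_elem (s x))(1 := x)))"

definition minimizer ::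
    "nat \<Rightarrow> (nat \<Rightarrow> 'a metric) \<Rightarrow> (nat \<Rightarrow> 'a measure) \<Rightarrow> ((nat \<Rightarrow> 'a) \<Rightarrow> real)
      \<Rightarrow> ('a \<Rightarrow> (nat \<Rightarrow> 'a) set) \<Rightarrow> bool" where
  "minimizer N X \<mu> c s \<longleftrightarrow>
    s \<in> class_S N X \<mu> \<and> (\<forall>t\<in>class_S N X \<mu>. transport_cost c (\<mu> 1) s \<le> transport_cost c (\<mu> 1) t)"

end

theory Submission
  imports Defs "HOL-Complex_Analysis.Great_Picard"
begin

text \<open>
  Every minimizer is forced onto the contact set of one solution of the dual problem.
  Call a tuple \<open>f\<close> of continuous functions admissible if \<open>f\<^sub>1(y\<^sub>1) + \<dots> + f\<^sub>N(y\<^sub>N) \<le> c(y)\<close> for all \<open>y\<close>, and let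
  its dual value be the sum of the integrals of \<open>f\<^sub>j\<close> against \<open>\<mu>\<^sub>j\<close>.
  If \<open>u\<close> transports \<open>\<mu>\<^sub>1\<close> to every \<open>\<mu>\<^sub>j\<close>, then integrating the admissibility inequality along
  \<open>(x, u x)\<close> shows that the cost of \<open>u\<close> is at least the dual value of \<open>f\<close>. Equality holds only if
  \<open>u x\<close> lies in the c-normal set of \<open>f\<close> at \<open>x\<close> for almost every \<open>x\<close> (\<open>zero_gap_in_c_normal\<close>).

  A c-conjugate \<open>f\<close> of maximal dual value exists (\<open>dual_maximizer\<close>). Replacing the components of a
  tuple by their c-transforms one after the other never lowers the dual value and produces a conjugate
  tuple. The components are then \<open>K\<close>-Lipschitz with the constant \<open>K\<close> of \<open>c\<close>, and adding constants
  of sum zero, which is neutral because all masses agree, makes them uniformly bounded. A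
  maximizing sequence therefore has a pointwise convergent subsequence.

  The key point is that the c-normal map of the maximizer is itself a competitor. By condition SV it
  is almost everywhere a single-valued map \<open>t\<close>. Let \<open>h\<close> be continuous on \<open>D\<^sub>j\<close>, replace \<open>f\<^sub>j\<close> by \<open>f\<^sub>j + \<epsilon> h\<close>
  and then \<open>f\<^sub>1\<close> by the c-transform of the new tuple. At a point where the minimum defining \<open>f\<^sub>1(x)\<close> is
  attained only at \<open>t x\<close>, the derivative of this c-transform at \<open>\<epsilon> = 0\<close> is \<open>- h (t\<^sub>j x)\<close>
  (\<open>c_transform_derivative\<close>). Maximality of the dual value, used for \<open>h\<close> and for \<open>- h\<close>, turns this into the
  equality of the integrals of \<open>h\<close> against \<open>\<mu>\<^sub>j\<close> and of \<open>h \<circ> t\<^sub>j\<close> against \<open>\<mu>\<^sub>1\<close>. Hence \<open>t\<^sub>j\<close> pushes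
  \<open>\<mu>\<^sub>1\<close> forward to \<open>\<mu>\<^sub>j\<close> (\<open>c_normal_transport_map\<close>).

  The cost of \<open>t\<close> equals the dual value of \<open>f\<close>, so no minimizer costs more. By the equality case
  every minimizer takes its values in the c-normal sets of \<open>f\<close>, which are the singletons \<open>{t x}\<close>
  almost everywhere. The map \<open>t\<close> was chosen before the minimizer, so all minimizers agree almost everywhere.
\<close>

section \<open>Continuous functions on products of compact metric spaces\<close>

lemma borel_of_sets:
  "sets (borel_of T) = sigma_sets (topspace T) {U. openin T U}"
  unfolding borel_of_def by (rule sets_measure_of) (auto dest: openin_subset)

lemma space_borel_of: "space (borel_of T) = topspace T"
  unfolding borel_of_def by (rule space_measure_of) (auto dest: openin_subset)

lemma borel_measurable_continuous_map:
  assumes h: "continuous_map T euclidean h" and M: "sets M = sets (borel_of T)"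
  shows "h \<in> borel_measurable M"
proof (rule borel_measurableI)
  fix S :: "'b set" assume "open S"
  have sp: "space M = topspace T"
    using sets_eq_imp_space_eq[OF M] by (simp add: space_borel_of)
  have "openin T {x \<in> topspace T. h x \<in> S}"
    using h \<open>open S\<close> by (auto intro: openin_continuous_map_preimage)
  moreover have "h -` S \<inter> space M = {x \<in> topspace T. h x \<in> S}"
    using sp by auto
  ultimately show "h -` S \<inter> space M \<in> sets M"
    by (simp add: M borel_of_sets sigma_sets.Basic)
qed

lemma prod_space_coordinate: "y \<in> prod_space X I \<Longrightarrow> i \<in> I \<Longrightarrow> y i \<in> mspace (X i)"
  by (auto simp: prod_space_def)

lemma continuous_map_attains_inf:
  fixes \<phi> :: "'b \<Rightarrow> real"
  assumes "compactin T A" "A \<noteq> {}" "continuous_map T euclideanreal \<phi>"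
  obtains x where "x \<in> A" "\<And>y. y \<in> A \<Longrightarrow> \<phi> x \<le> \<phi> y"
proof -
  have "compact (\<phi> ` A)"
    using image_compactin[OF assms(1,3)] by simp
  then obtain m where "m \<in> \<phi> ` A" "\<And>t. t \<in> \<phi> ` A \<Longrightarrow> m \<le> t"
    using compact_attains_inf[of "\<phi> ` A"] assms(2) by blast
  then show thesis using that by auto
qed

lemma continuous_map_bounded:
  fixes \<phi> :: "'b \<Rightarrow> real"
  assumes "compact_space T" "continuous_map T euclideanreal \<phi>"
  obtains B where "0 \<le> B" "\<And>x. x \<in> topspace T \<Longrightarrow> \<bar>\<phi> x\<bar> \<le> B"
proof -
  have "compact (\<phi> ` topspace T)"
    using image_compactin[OF _ assms(2), of "topspace T"] assms(1) by (simp add: compact_space_def)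
  then obtain b where b: "\<And>t. t \<in> \<phi> ` topspace T \<Longrightarrow> \<bar>t\<bar> \<le> b"
    using compact_imp_bounded bounded_iff by (metis real_norm_def)
  then show thesis using that[of "max b 0"] by (meson image_eqI max.cobounded1 max.cobounded2 order_trans)
qed

text \<open>
  The summed distance to a fixed point is itself continuous for the product topology, so its
  sublevel sets are open neighbourhoods on which \<open>\<phi>\<close> varies little.
\<close>

lemma continuous_map_summed_lipschitz:
  fixes \<phi> :: "(nat \<Rightarrow> 'a) \<Rightarrow> real"
  assumes I: "finite I"
    and lip: "\<And>y z. y \<in> prod_space X I \<Longrightarrow> z \<in> prod_space X I \<Longrightarrow>
      \<bar>\<phi> y - \<phi> z\<bar> \<le> K * (\<Sum>i\<in>I. mdist (X i) (y i) (z i))"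
  shows "continuous_map (product_topology (\<lambda>i. mtopology_of (X i)) I) euclideanreal \<phi>"
proof -
  let ?T = "product_topology (\<lambda>i. mtopology_of (X i)) I"
  have top: "topspace ?T = prod_space X I"
    by (simp add: prod_space_def)
  have "\<exists>U. openin ?T U \<and> x \<in> U \<and> (\<forall>y\<in>U. \<phi> y \<in> ball (\<phi> x) e)"
    if x: "x \<in> prod_space X I" and e: "e > 0" for x e
  proof -
    define D where "D = (\<lambda>y. K * (\<Sum>i\<in>I. mdist (X i) (x i) (y i)))"
    have xi: "x i \<in> mspace (X i)" if "i \<in> I" for i
      using x that by (auto simp: prod_space_def)
    have cont: "continuous_map ?T euclideanreal (\<lambda>y. mdist (X i) (x i) (y i))" if "i \<in> I" for i
      using continuous_map_compose[OF continuous_map_product_projection[OF that, of "\<lambda>i. mtopology_of (X i)"],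
          of euclideanreal "mdist (X i) (x i)"] xi[OF that]
      by (simp add: continuous_map_mdist o_def)
    have "continuous_map ?T euclideanreal D"
      unfolding D_def by (intro continuous_map_real_mult_left continuous_map_sum I cont)
    then have "openin ?T {y \<in> topspace ?T. D y \<in> {..<e}}"
      by (rule openin_continuous_map_preimage) auto
    moreover have "x \<in> {y \<in> topspace ?T. D y \<in> {..<e}}"
    proof -
      have "(\<Sum>i\<in>I. mdist (X i) (x i) (x i)) = 0"
        using xi by (intro sum.neutral) auto
      then show ?thesis using x e by (simp only: D_def top mem_Collect_eq lessThan_iff) simp
    qed
    moreover have "\<phi> y \<in> ball (\<phi> x) e" if "y \<in> {y \<in> topspace ?T. D y \<in> {..<e}}" for y
      using that lip[OF x, of y] unfolding top by (auto simp: D_def dist_real_def)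
    ultimately show ?thesis by blast
  qed
  then show ?thesis
    using Met_TC.continuous_map_to_metric[of ?T \<phi>] unfolding top by simp
qed

lemma lipschitz_imp_continuous_map:
  fixes g :: "'a \<Rightarrow> real"
  assumes "\<And>x y. x \<in> mspace m \<Longrightarrow> y \<in> mspace m \<Longrightarrow> \<bar>g x - g y\<bar> \<le> B * mdist m x y"
  shows "continuous_map (mtopology_of m) euclideanreal g"
  using Lipschitz_continuous_imp_continuous_map[of m euclidean_metric g] assms
  by (auto simp: Lipschitz_continuous_map_def dist_real_def)

lemma compact_metric_countable_dense:
  assumes "compact_space (mtopology_of m)"
  obtains Q where "countable Q" "Q \<subseteq> mspace m"
    "\<And>x e. x \<in> mspace m \<Longrightarrow> e > 0 \<Longrightarrow> \<exists>q\<in>Q. mdist m x q < e"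
proof -
  interpret Metric_space "mspace m" "mdist m" by simp
  have tb: "mtotally_bounded (mspace m)"
    using assms by (simp add: mtopology_of_def compact_space_eq_mcomplete_mtotally_bounded)
  have "\<forall>n. \<exists>F. finite F \<and> F \<subseteq> mspace m \<and> mspace m \<subseteq> (\<Union>x\<in>F. mball x (1 / real (Suc n)))"
    using tb unfolding mtotally_bounded_def by auto
  then obtain F where F: "\<And>n. finite (F n)" "\<And>n. F n \<subseteq> mspace m"
      "\<And>n. mspace m \<subseteq> (\<Union>x\<in>F n. mball x (1 / real (Suc n)))" by metis
  show thesis
  proof
    show "countable (\<Union>n. F n)" using F(1) by (simp add: countable_finite)
    show "(\<Union>n. F n) \<subseteq> mspace m" using F(2) by auto
    fix x and e :: real assume x: "x \<in> mspace m" and e: "e > 0"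
    obtain n where n: "1 / real (Suc n) < e" using e nat_approx_posE by blast
    obtain q where "q \<in> F n" "x \<in> mball q (1 / real (Suc n))" using F(3)[of n] x by blast
    then show "\<exists>q\<in>\<Union>n. F n. mdist m x q < e"
      using n by (intro bexI[of _ q]) (auto simp: mdist_commute[of m x q])
  qed
qed

section \<open>Potentials and c-transforms\<close>

locale compact_lipschitz_cost =
  fixes N :: nat and X :: "nat \<Rightarrow> 'a metric" and c :: "(nat \<Rightarrow> 'a) \<Rightarrow> real" and K :: real
  assumes two_le: "2 \<le> N"
    and nonempty: "\<And>j. j \<in> {1..N} \<Longrightarrow> mspace (X j) \<noteq> {}"
    and compact: "\<And>j. j \<in> {1..N} \<Longrightarrow> compact_space (mtopology_of (X j))"
    and K_pos: "0 < K"
    and lipschitz: "\<And>x y. x \<in> prod_space X {1..N} \<Longrightarrow> y \<in> prod_space X {1..N} \<Longrightarrow>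
      \<bar>c x - c y\<bar> \<le> K * (\<Sum>i=1..N. mdist (X i) (x i) (y i))"
begin

abbreviation product_top :: "nat set \<Rightarrow> (nat \<Rightarrow> 'a) topology" where
  "product_top I \<equiv> product_topology (\<lambda>i. mtopology_of (X i)) I"

abbreviation transform :: "(nat \<Rightarrow> 'a \<Rightarrow> real) \<Rightarrow> nat \<Rightarrow> 'a \<Rightarrow> real" where
  "transform \<equiv> c_transform N X c"

definition potentials :: "(nat \<Rightarrow> 'a \<Rightarrow> real) \<Rightarrow> bool" where
  "potentials f \<longleftrightarrow> (\<forall>j\<in>{1..N}. continuous_map (mtopology_of (X j)) euclideanreal (f j))"

definition admissible :: "(nat \<Rightarrow> 'a \<Rightarrow> real) \<Rightarrow> bool" where
  "admissible f \<longleftrightarrow> (\<forall>y\<in>prod_space X {1..N}. (\<Sum>i=1..N. f i (y i)) \<le> c y)"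

lemma topspace_product_top: "topspace (product_top I) = prod_space X I"
  by (simp add: prod_space_def)

lemma compact_product_top: "I \<subseteq> {1..N} \<Longrightarrow> compact_space (product_top I)"
  using compact by (auto simp: compact_space_product_topology)

lemma prod_space_nonempty: "I \<subseteq> {1..N} \<Longrightarrow> prod_space X I \<noteq> {}"
  using nonempty by (auto simp: prod_space_def PiE_eq_empty_iff)

lemma prod_space_update:
  "j \<in> {1..N} \<Longrightarrow> x \<in> mspace (X j) \<Longrightarrow> z \<in> prod_space X ({1..N} - {j}) \<Longrightarrow>
    z(j := x) \<in> prod_space X {1..N}"
  by (auto simp: prod_space_def PiE_iff extensional_def)

lemma sum_update:
  fixes f :: "nat \<Rightarrow> 'a \<Rightarrow> real"
  assumes "j \<in> {1..N}"
  shows "(\<Sum>i=1..N. f i ((z(j := x)) i)) = f j x + (\<Sum>k\<in>{1..N} - {j}. f k (z k))"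
  using assms by (subst sum.remove[of _ j]) auto

lemma split_coordinate:
  assumes "j \<in> {1..N}" "y \<in> prod_space X {1..N}"
  obtains z x where "x \<in> mspace (X j)" "z \<in> prod_space X ({1..N} - {j})" "y = z(j := x)"
proof
  show "y j \<in> mspace (X j)" using assms by (auto simp: prod_space_def)
  show "restrict y ({1..N} - {j}) \<in> prod_space X ({1..N} - {j})"
    using assms by (auto simp: prod_space_def)
  show "y = (restrict y ({1..N} - {j}))(j := y j)"
    using assms by (auto simp: prod_space_def PiE_iff extensional_def)
qed

lemma continuous_map_sum_potentials:
  assumes "potentials f" "I \<subseteq> {1..N}"
  shows "continuous_map (product_top I) euclideanreal (\<lambda>z. \<Sum>k\<in>I. f k (z k))"
proof (intro continuous_map_sum)
  show "finite I" using assms(2) finite_subset by auto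
  fix i assume i: "i \<in> I"
  have "continuous_map (mtopology_of (X i)) euclideanreal (f i)"
    using assms i by (auto simp: potentials_def)
  from continuous_map_compose[OF
      continuous_map_product_projection[OF i, of "\<lambda>i. mtopology_of (X i)"] this]
  show "continuous_map (product_top I) euclideanreal (\<lambda>z. f i (z i))" by (simp add: o_def)
qed

lemma lipschitz_update:
  assumes j: "j \<in> {1..N}" and x: "x \<in> mspace (X j)" "x' \<in> mspace (X j)"
    and z: "z \<in> prod_space X ({1..N} - {j})" "z' \<in> prod_space X ({1..N} - {j})"
  shows "\<bar>c (z(j := x)) - c (z'(j := x'))\<bar> \<le>
    K * (mdist (X j) x x' + (\<Sum>i\<in>{1..N} - {j}. mdist (X i) (z i) (z' i)))"
proof -
  have "(\<Sum>i=1..N. mdist (X i) ((z(j := x)) i) ((z'(j := x')) i)) =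
      mdist (X j) x x' + (\<Sum>i\<in>{1..N} - {j}. mdist (X i) (z i) (z' i))"
    using j by (subst sum.remove[of _ j]) auto
  then show ?thesis
    using lipschitz[OF prod_space_update[OF j x(1) z(1)] prod_space_update[OF j x(2) z(2)]] by simp
qed

lemma continuous_map_slice:
  assumes f: "potentials f" and j: "j \<in> {1..N}" and x: "x \<in> mspace (X j)"
  shows "continuous_map (product_top ({1..N} - {j})) euclideanreal
    (\<lambda>z. c (z(j := x)) - (\<Sum>k\<in>{1..N} - {j}. f k (z k)))"
proof (intro continuous_map_diff continuous_map_sum_potentials[OF f])
  show "continuous_map (product_top ({1..N} - {j})) euclideanreal (\<lambda>z. c (z(j := x)))"
  proof (rule continuous_map_summed_lipschitz[where K = K])
    show "\<bar>c (y(j := x)) - c (z(j := x))\<bar> \<le> K * (\<Sum>i\<in>{1..N} - {j}. mdist (X i) (y i) (z i))"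
      if "y \<in> prod_space X ({1..N} - {j})" "z \<in> prod_space X ({1..N} - {j})" for y z
      using lipschitz_update[OF j x x that] mdist_zero[OF x x] by simp
  qed simp
qed auto

text \<open>
  By compactness the infimum in the c-transform of continuous functions is a minimum. This replaces
  all reasoning about bounds of infima below by the choice of a minimizing point.
\<close>

lemma c_transform_minimum:
  assumes f: "potentials f" and j: "j \<in> {1..N}" and x: "x \<in> mspace (X j)"
  defines "\<phi> \<equiv> \<lambda>z. c (z(j := x)) - (\<Sum>k\<in>{1..N} - {j}. f k (z k))"
  shows "\<exists>z\<in>prod_space X ({1..N} - {j}). transform f j x = \<phi> z \<and>
    (\<forall>w\<in>prod_space X ({1..N} - {j}). \<phi> z \<le> \<phi> w)"
proof -
  let ?A = "prod_space X ({1..N} - {j})"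
  have "compactin (product_top ({1..N} - {j})) ?A"
    using compact_product_top[of "{1..N} - {j}"] unfolding compact_space_def topspace_product_top by blast
  moreover have "?A \<noteq> {}" by (rule prod_space_nonempty) auto
  moreover have "continuous_map (product_top ({1..N} - {j})) euclideanreal \<phi>"
    unfolding \<phi>_def by (rule continuous_map_slice[OF f j x])
  ultimately obtain z where z: "z \<in> ?A" "\<And>w. w \<in> ?A \<Longrightarrow> \<phi> z \<le> \<phi> w"
    by (rule continuous_map_attains_inf) blast
  have "transform f j x = Inf (\<phi> ` ?A)"
    by (simp add: c_transform_def \<phi>_def)
  also have "\<dots> = \<phi> z"
    using z by (intro cInf_eq_minimum) auto
  finally show ?thesis using z by blast
qed

lemma c_transform_attained:
  assumes "potentials f" "j \<in> {1..N}" "x \<in> mspace (X j)"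
  obtains z where "z \<in> prod_space X ({1..N} - {j})"
    "transform f j x = c (z(j := x)) - (\<Sum>k\<in>{1..N} - {j}. f k (z k))"
  using c_transform_minimum[OF assms] by blast

lemma c_transform_le:
  assumes "potentials f" "j \<in> {1..N}" "x \<in> mspace (X j)" "w \<in> prod_space X ({1..N} - {j})"
  shows "transform f j x \<le> c (w(j := x)) - (\<Sum>k\<in>{1..N} - {j}. f k (w k))"
  using c_transform_minimum[OF assms(1-3)] assms(4) by force

text \<open>
  A minimizing point for one argument is a competitor for the other, and moving the argument changes
  the cost by at most \<open>K\<close> times the distance. The constant does not depend on \<open>f\<close>, which is what makes
  conjugate tuples equicontinuous.
\<close>

lemma c_transform_lipschitz:
  assumes f: "potentials f" and j: "j \<in> {1..N}" and x: "x \<in> mspace (X j)" "x' \<in> mspace (X j)"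
  shows "\<bar>transform f j x - transform f j x'\<bar> \<le> K * mdist (X j) x x'"
proof -
  have *: "transform f j u \<le> transform f j v + K * mdist (X j) u v"
    if u: "u \<in> mspace (X j)" and v: "v \<in> mspace (X j)" for u v
  proof -
    obtain z where z: "z \<in> prod_space X ({1..N} - {j})"
        "transform f j v = c (z(j := v)) - (\<Sum>k\<in>{1..N} - {j}. f k (z k))"
      by (rule c_transform_attained[OF f j v])
    have "(\<Sum>i\<in>{1..N} - {j}. mdist (X i) (z i) (z i)) = 0"
      using z(1) by (intro sum.neutral) (auto simp: prod_space_def PiE_iff)
    then show ?thesis
      using c_transform_le[OF f j u z(1)] lipschitz_update[OF j u v z(1) z(1)] z(2) by simp
  qed
  show ?thesis using *[OF x] *[OF x(2,1)] by (simp add: mdist_commute abs_le_iff)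
qed

lemma potentials_update_transform:
  assumes "potentials f" "j \<in> {1..N}"
  shows "potentials (f(j := transform f j))"
  using assms lipschitz_imp_continuous_map[OF c_transform_lipschitz[OF assms]]
  by (auto simp: potentials_def)

lemma admissible_update_transform:
  assumes f: "potentials f" and j: "j \<in> {1..N}"
  shows "admissible (f(j := transform f j))"
  unfolding admissible_def
proof
  fix y assume "y \<in> prod_space X {1..N}"
  then obtain z x where *: "x \<in> mspace (X j)" "z \<in> prod_space X ({1..N} - {j})" "y = z(j := x)"
    by (rule split_coordinate[OF j])
  have "(\<Sum>k\<in>{1..N} - {j}. (f(j := transform f j)) k (z k)) = (\<Sum>k\<in>{1..N} - {j}. f k (z k))"
    by (intro sum.cong) auto
  then show "(\<Sum>i=1..N. (f(j := transform f j)) i (y i)) \<le> c y"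
    unfolding *(3) sum_update[OF j, of "f(j := transform f j)"]
    using c_transform_le[OF f j *(1,2)] by simp
qed

lemma admissible_le_transform:
  assumes f: "potentials f" "admissible f" and j: "j \<in> {1..N}" and x: "x \<in> mspace (X j)"
  shows "f j x \<le> transform f j x"
proof -
  obtain z where z: "z \<in> prod_space X ({1..N} - {j})"
      "transform f j x = c (z(j := x)) - (\<Sum>k\<in>{1..N} - {j}. f k (z k))"
    by (rule c_transform_attained[OF f(1) j x])
  then show ?thesis
    using f(2) prod_space_update[OF j x z(1)] sum_update[OF j, of f z x]
    by (force simp: admissible_def)
qed

lemma c_transform_antimono:
  assumes "potentials f" "potentials g" and j: "j \<in> {1..N}" and x: "x \<in> mspace (X j)"
    and le: "\<And>k y. k \<in> {1..N} - {j} \<Longrightarrow> y \<in> mspace (X k) \<Longrightarrow> f k y \<le> g k y"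
  shows "transform g j x \<le> transform f j x"
proof -
  obtain z where z: "z \<in> prod_space X ({1..N} - {j})"
      "transform f j x = c (z(j := x)) - (\<Sum>k\<in>{1..N} - {j}. f k (z k))"
    by (rule c_transform_attained[OF assms(1) j x])
  have "(\<Sum>k\<in>{1..N} - {j}. f k (z k)) \<le> (\<Sum>k\<in>{1..N} - {j}. g k (z k))"
  proof (rule sum_mono)
    fix k assume k: "k \<in> {1..N} - {j}"
    then have "z k \<in> mspace (X k)" using prod_space_coordinate[OF z(1)] by blast
    then show "f k (z k) \<le> g k (z k)" by (rule le[OF k])
  qed
  then show ?thesis using z(2) c_transform_le[OF assms(2) j x z(1)] by simp
qed

text \<open>
  One sweep over the components suffices. Replacing \<open>f\<^sub>j\<close> by its c-transform gives a larger admissible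
  tuple, and a component that already equals its c-transform keeps this property when another one is
  increased: its c-transform can only decrease, while admissibility keeps it above the component.
\<close>

lemma conjugate_improvement:
  assumes f: "potentials f" "admissible f"
  obtains g where "potentials g" "admissible g" "c_conjugate N X c g"
    "\<And>j x. j \<in> {1..N} \<Longrightarrow> x \<in> mspace (X j) \<Longrightarrow> f j x \<le> g j x"
proof -
  have "\<exists>g. potentials g \<and> admissible g \<and> (\<forall>j\<in>{1..N}. \<forall>x\<in>mspace (X j). f j x \<le> g j x) \<and>
      (\<forall>j\<in>{1..m}. \<forall>x\<in>mspace (X j). g j x = transform g j x)" if "m \<le> N" for m
    using that
  proof (induction m)
    case 0
    then show ?case using f by (intro exI[of _ f]) auto
  next
    case (Suc m)
    then obtain g where g: "potentials g" "admissible g"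
        "\<And>j x. j \<in> {1..N} \<Longrightarrow> x \<in> mspace (X j) \<Longrightarrow> f j x \<le> g j x"
        "\<And>j x. j \<in> {1..m} \<Longrightarrow> x \<in> mspace (X j) \<Longrightarrow> g j x = transform g j x"
      by (meson Suc_leD)
    \<comment> \<open>the components up to \<open>m\<close> are already conjugate; the next one is replaced\<close>
    define h where "h = g(Suc m := transform g (Suc m))"
    have j: "Suc m \<in> {1..N}" using Suc.prems by auto
    have h: "potentials h" "admissible h"
      unfolding h_def using potentials_update_transform[OF g(1) j]
        admissible_update_transform[OF g(1) j] by auto
    have gh: "g k x \<le> h k x" if "k \<in> {1..N}" "x \<in> mspace (X k)" for k x
      using admissible_le_transform[OF g(1,2) j] that by (auto simp: h_def)
    have "h k x = transform h k x" if k: "k \<in> {1..Suc m}" and x: "x \<in> mspace (X k)" for k x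
    proof (cases "k = Suc m")
      case True
      \<comment> \<open>the c-transform with index \<open>k\<close> does not look at component \<open>k\<close>\<close>
      have "transform h k x = transform g k x"
        unfolding c_transform_def h_def True by (intro arg_cong[of _ _ Inf] image_cong) auto
      then show ?thesis by (simp add: h_def True)
    next
      case False
      have k': "k \<in> {1..N}" using k Suc.prems by auto
      have "transform h k x \<le> transform g k x"
        using gh by (intro c_transform_antimono g h k' x) auto
      moreover have "transform g k x = h k x" using g(4)[of k x] k x False by (simp add: h_def)
      ultimately show ?thesis using admissible_le_transform[OF h k' x] by simp
    qed
    moreover have "f k x \<le> h k x" if "k \<in> {1..N}" "x \<in> mspace (X k)" for k x
      using g(3)[OF that] gh[OF that] by simp
    ultimately show ?case using h by blast
  qed
  from this[of N] show thesis using that unfolding c_conjugate_def by blast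
qed

lemma conjugate_admissible:
  assumes "potentials f" "c_conjugate N X c f"
  shows "admissible f"
proof -
  have j: "1 \<in> {1..N}" using two_le by auto
  have *: "(f(1 := transform f 1)) i (y i) = f i (y i)" if "y \<in> prod_space X {1..N}" "i \<in> {1..N}" for i y
    using assms(2) that unfolding c_conjugate_def prod_space_def PiE_iff by (simp add: fun_upd_def)
  show ?thesis
    unfolding admissible_def
  proof
    fix y assume y: "y \<in> prod_space X {1..N}"
    have "(\<Sum>i=1..N. (f(1 := transform f 1)) i (y i)) = (\<Sum>i=1..N. f i (y i))"
      by (rule sum.cong[OF refl *[OF y]])
    then show "(\<Sum>i=1..N. f i (y i)) \<le> c y"
      using admissible_update_transform[OF assms(1) j] y unfolding admissible_def by metis
  qed
qed

lemma without_one: "{1..N} - {1} = {2..N}"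
  by auto

lemma one_in: "1 \<in> {1..N}"
  using two_le by auto

lemmas transform_one_attained = c_transform_attained[OF _ one_in, unfolded without_one]
lemmas transform_one_le = c_transform_le[OF _ one_in, unfolded without_one]

lemma c_normal_nonempty:
  assumes f: "potentials f" "c_conjugate N X c f" and x: "x \<in> mspace (X 1)"
  shows "c_normal N X c f x \<noteq> {}"
proof -
  obtain z where "z \<in> prod_space X {2..N}" "transform f 1 x = c (z(1 := x)) - (\<Sum>k=2..N. f k (z k))"
    by (rule transform_one_attained[OF f(1) x])
  moreover have "f 1 x = transform f 1 x" using f(2) one_in x by (auto simp: c_conjugate_def)
  ultimately show ?thesis by (auto simp: c_normal_def)
qed

section \<open>First variation of the c-transform\<close>

text \<open>
  The step sizes \<open>1 / (n + 1)\<close> form a sequence tending to zero, so that dominated convergence along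
  \<open>n\<close> applies to the difference quotients.
\<close>

definition perturbed :: "(nat \<Rightarrow> 'a \<Rightarrow> real) \<Rightarrow> nat \<Rightarrow> ('a \<Rightarrow> real) \<Rightarrow> nat \<Rightarrow> nat \<Rightarrow> 'a \<Rightarrow> real" where
  "perturbed f j h n = f(j := \<lambda>y. f j y + h y / real (Suc n))"

lemma potentials_perturbed:
  assumes "potentials f" "j \<in> {1..N}" "continuous_map (mtopology_of (X j)) euclideanreal h"
  shows "potentials (perturbed f j h n)"
proof -
  have "continuous_map (mtopology_of (X j)) euclideanreal (\<lambda>y. f j y + h y / real (Suc n))"
    using assms by (intro continuous_map_add continuous_map_real_divide) (auto simp: potentials_def)
  then show ?thesis using assms by (auto simp: potentials_def perturbed_def)
qed

lemma sum_perturbed: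
  assumes "j \<in> {2..N}"
  shows "(\<Sum>k=2..N. perturbed f j h n k (w k)) = (\<Sum>k=2..N. f k (w k)) + h (w j) / real (Suc n)"
proof -
  have "(\<Sum>k\<in>{2..N} - {j}. perturbed f j h n k (w k)) = (\<Sum>k\<in>{2..N} - {j}. f k (w k))"
    by (intro sum.cong) (auto simp: perturbed_def)
  then show ?thesis
    using assms by (simp add: sum.remove[of _ j] perturbed_def)
qed

text \<open>
  A minimizing point for \<open>f\<close> and one for the perturbed tuple bound the difference quotient between
  two values of \<open>h\<close>. The bound is uniform in \<open>x\<close> and \<open>n\<close>, as dominated convergence requires.
\<close>

lemma difference_quotient_bounded:
  assumes f: "potentials f" "c_conjugate N X c f" and j: "j \<in> {2..N}"
    and h: "continuous_map (mtopology_of (X j)) euclideanreal h"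
    and H: "\<And>y. y \<in> mspace (X j) \<Longrightarrow> \<bar>h y\<bar> \<le> H" and x: "x \<in> mspace (X 1)"
  shows "\<bar>real (Suc n) * (f 1 x - transform (perturbed f j h n) 1 x)\<bar> \<le> H"
proof -
  have j1: "j \<in> {1..N}" using j by auto
  have fx: "f 1 x = transform f 1 x" using f(2) one_in x by (auto simp: c_conjugate_def)
  let ?p = "perturbed f j h n"
  note p = potentials_perturbed[OF f(1) j1 h, of n]
  obtain z where z: "z \<in> prod_space X {2..N}" "transform f 1 x = c (z(1 := x)) - (\<Sum>k=2..N. f k (z k))"
    by (rule transform_one_attained[OF f(1) x])
  obtain w where w: "w \<in> prod_space X {2..N}" "transform ?p 1 x = c (w(1 := x)) - (\<Sum>k=2..N. ?p k (w k))"
    by (rule transform_one_attained[OF p x])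
  have zj: "z j \<in> mspace (X j)" "w j \<in> mspace (X j)" using z w j by (auto simp: prod_space_def)
  have "f 1 x - transform ?p 1 x \<le> h (w j) / real (Suc n)"
    using transform_one_le[OF f(1) x, of w] w unfolding fx sum_perturbed[OF j] by simp
  moreover have "f 1 x - transform ?p 1 x \<ge> h (z j) / real (Suc n)"
    using transform_one_le[OF p x, of z] z unfolding fx sum_perturbed[OF j] by simp
  ultimately have "h (z j) \<le> real (Suc n) * (f 1 x - transform ?p 1 x)"
      "real (Suc n) * (f 1 x - transform ?p 1 x) \<le> h (w j)"
    by (simp_all add: field_simps)
  then show ?thesis using H[OF zj(1)] H[OF zj(2)] by linarith
qed

text \<open>
  This is an envelope theorem. The unique minimizing point \<open>z\<close> gives the lower bound \<open>h (z j)\<close> for every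
  \<open>n\<close>. For the upper bound, the points \<open>w\<close> with \<open>h (w j) \<ge> h (z j) + \<delta> / 2\<close> form a compact set without
  \<open>z\<close>, on which the unperturbed expression exceeds its minimum by some \<open>\<eta> > 0\<close>. A perturbation of size
  below \<open>\<eta>\<close> cannot move the minimizing point into this set.
\<close>

lemma c_transform_derivative:
  assumes f: "potentials f" "c_conjugate N X c f" and j: "j \<in> {2..N}"
    and h: "continuous_map (mtopology_of (X j)) euclideanreal h" and x: "x \<in> mspace (X 1)"
    and z: "c_normal N X c f x = {z}"
  shows "(\<lambda>n. real (Suc n) * (f 1 x - transform (perturbed f j h n) 1 x)) \<longlonglongrightarrow> h (z j)"
proof -
  have j1: "j \<in> {1..N}" using j by auto
  have fx: "f 1 x = transform f 1 x" using f(2) one_in x by (auto simp: c_conjugate_def)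
  let ?p = "perturbed f j h"
  note p = potentials_perturbed[OF f(1) j1 h]
  have zP: "z \<in> prod_space X {2..N}" "f 1 x = c (z(1 := x)) - (\<Sum>k=2..N. f k (z k))"
    using z unfolding c_normal_def set_eq_iff by force+
  have lower: "h (z j) \<le> real (Suc n) * (f 1 x - transform (?p n) 1 x)" for n
  proof -
    have "f 1 x - transform (?p n) 1 x \<ge> h (z j) / real (Suc n)"
      using transform_one_le[OF p x zP(1), of n] zP(2) unfolding sum_perturbed[OF j] by linarith
    then show ?thesis by (simp add: field_simps)
  qed
  obtain H where H: "0 \<le> H" "\<And>y. y \<in> mspace (X j) \<Longrightarrow> \<bar>h y\<bar> \<le> H"
    using continuous_map_bounded[OF compact[OF j1] h] by auto
  let ?T = "product_top {2..N}"
  let ?\<phi> = "\<lambda>w. c (w(1 := x)) - (\<Sum>k=2..N. f k (w k))"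
  have \<phi>: "continuous_map ?T euclideanreal ?\<phi>"
    using continuous_map_slice[OF f(1) one_in x] unfolding without_one .
  have le\<phi>: "f 1 x \<le> ?\<phi> w" if "w \<in> prod_space X {2..N}" for w
    using transform_one_le[OF f(1) x, of w] that unfolding fx by simp
  have hj: "continuous_map ?T euclideanreal (\<lambda>w. h (w j))"
    using continuous_map_compose[OF
        continuous_map_product_projection[OF j, of "\<lambda>i. mtopology_of (X i)"] h] by (simp add: o_def)
  have upper: "\<forall>\<^sub>F n in sequentially. real (Suc n) * (f 1 x - transform (?p n) 1 x) < h (z j) + \<delta>"
    if \<delta>: "\<delta> > 0" for \<delta>
  proof -
    define A where "A = {w \<in> topspace ?T. h (w j) \<in> {h (z j) + \<delta> / 2..}}"
    have "closedin ?T A"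
      unfolding A_def using hj by (rule closedin_continuous_map_preimage) auto
    moreover have "compactin ?T (topspace ?T)"
      using compact_product_top[of "{2..N}"] by (auto simp: compact_space_def)
    ultimately have A: "compactin ?T A"
      using closed_compactin closedin_subset by blast
    have "\<exists>\<eta>>0. \<forall>w\<in>A. f 1 x + \<eta> \<le> ?\<phi> w"
    proof (cases "A = {}")
      case True
      then show ?thesis by (intro exI[of _ 1]) auto
    next
      case False
      obtain v where v: "v \<in> A" "\<And>w. w \<in> A \<Longrightarrow> ?\<phi> v \<le> ?\<phi> w"
        by (rule continuous_map_attains_inf[OF A False \<phi>]) blast
      have vP: "v \<in> prod_space X {2..N}" using v(1) unfolding A_def topspace_product_top by blast
      have "v \<noteq> z" using v(1) \<delta> by (auto simp: A_def)
      then have "v \<notin> c_normal N X c f x" using z by simp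
      then have "f 1 x \<noteq> ?\<phi> v" using vP by (auto simp: c_normal_def)
      then have "f 1 x < ?\<phi> v" using le\<phi>[OF vP] by simp
      then show ?thesis using v(2) by (intro exI[of _ "?\<phi> v - f 1 x"]) auto
    qed
    then obtain \<eta> where \<eta>: "\<eta> > 0" "\<And>w. w \<in> A \<Longrightarrow> f 1 x + \<eta> \<le> ?\<phi> w" by blast
    have "(\<lambda>n. 2 * H * inverse (real (Suc n))) \<longlonglongrightarrow> 2 * H * 0"
      by (intro tendsto_mult tendsto_const LIMSEQ_inverse_real_of_nat)
    then have "\<forall>\<^sub>F n in sequentially. 2 * H * inverse (real (Suc n)) < \<eta>"
      using \<eta>(1) order_tendstoD(2) by fastforce
    then show ?thesis
    proof eventually_elim
      case (elim n)
      obtain w where w: "w \<in> prod_space X {2..N}"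
          "transform (?p n) 1 x = ?\<phi> w - h (w j) / real (Suc n)"
        by (rule transform_one_attained[OF p x, of n, unfolded sum_perturbed[OF j] diff_diff_eq[symmetric]])
      have wj: "\<bar>h (w j)\<bar> \<le> H" "\<bar>h (z j)\<bar> \<le> H"
        using w(1) zP(1) j by (auto intro!: H(2) simp: prod_space_def)
      have "w \<notin> A"
      proof
        assume "w \<in> A"
        then have "f 1 x - transform (?p n) 1 x \<le> h (w j) / real (Suc n) - \<eta>"
          using \<eta>(2) w(2) by fastforce
        moreover have "f 1 x - transform (?p n) 1 x \<ge> h (z j) / real (Suc n)"
          using lower[of n] by (simp add: field_simps)
        ultimately have "\<eta> \<le> (h (w j) - h (z j)) / real (Suc n)"
          by (simp add: diff_divide_distrib)
        also have "\<dots> \<le> 2 * H / real (Suc n)"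
          using wj by (intro divide_right_mono) auto
        finally show False using elim by (simp add: divide_inverse)
      qed
      then have "h (w j) < h (z j) + \<delta> / 2" using w(1) unfolding A_def topspace_product_top by force
      moreover have "f 1 x - transform (?p n) 1 x \<le> h (w j) / real (Suc n)"
        using le\<phi>[OF w(1)] w(2) by simp
      then have "real (Suc n) * (f 1 x - transform (?p n) 1 x) \<le> h (w j)"
        by (simp add: field_simps)
      ultimately show ?case using \<delta> by simp
    qed
  qed
  show ?thesis
  proof (rule order_tendstoI)
    fix a assume "a < h (z j)"
    then show "\<forall>\<^sub>F n in sequentially. a < real (Suc n) * (f 1 x - transform (?p n) 1 x)"
      by (intro always_eventually allI) (rule less_le_trans[OF _ lower])
  next
    fix a assume "h (z j) < a"
    then show "\<forall>\<^sub>F n in sequentially. real (Suc n) * (f 1 x - transform (?p n) 1 x) < a"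
      using upper[of "a - h (z j)"] by simp
  qed
qed

end



section \<open>Existence of a dual maximizer\<close>

locale transport_problem = compact_lipschitz_cost N X c K
  for N :: nat and X :: "nat \<Rightarrow> 'a metric" and c :: "(nat \<Rightarrow> 'a) \<Rightarrow> real" and K :: real +
  fixes \<mu> :: "nat \<Rightarrow> 'a measure"
  assumes finite_measures: "\<And>j. j \<in> {1..N} \<Longrightarrow> finite_measure (\<mu> j)"
    and sets_\<mu>: "\<And>j. j \<in> {1..N} \<Longrightarrow> sets (\<mu> j) = sets (borel_of (mtopology_of (X j)))"
    and equal_mass: "\<And>j. j \<in> {2..N} \<Longrightarrow> emeasure (\<mu> 1) (mspace (X 1)) = emeasure (\<mu> j) (mspace (X j))"
begin

lemma space_\<mu>: "j \<in> {1..N} \<Longrightarrow> space (\<mu> j) = mspace (X j)"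
  using sets_eq_imp_space_eq[OF sets_\<mu>] by (simp add: space_borel_of)

definition mass :: real where
  "mass = measure (\<mu> 1) (space (\<mu> 1))"

lemma measure_space_\<mu>:
  assumes "j \<in> {1..N}"
  shows "measure (\<mu> j) (space (\<mu> j)) = mass"
proof (cases "j = 1")
  case False
  then have "j \<in> {2..N}" using assms by auto
  then show ?thesis
    using equal_mass[of j] assms one_in by (simp only: mass_def measure_def space_\<mu>)
qed (simp add: mass_def)

lemma borel_measurable_continuous:
  fixes h :: "'a \<Rightarrow> real"
  shows "j \<in> {1..N} \<Longrightarrow> continuous_map (mtopology_of (X j)) euclideanreal h \<Longrightarrow> h \<in> borel_measurable (\<mu> j)"
  by (rule borel_measurable_continuous_map[OF _ sets_\<mu>])

lemma integrable_continuous: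
  fixes h :: "'a \<Rightarrow> real"
  assumes j: "j \<in> {1..N}" and h: "continuous_map (mtopology_of (X j)) euclideanreal h"
  shows "integrable (\<mu> j) h"
proof -
  obtain B where "\<And>x. x \<in> mspace (X j) \<Longrightarrow> \<bar>h x\<bar> \<le> B"
    using continuous_map_bounded[OF compact[OF j] h] by auto
  then have "AE x in \<mu> j. norm (h x) \<le> B"
    using space_\<mu>[OF j] by (intro AE_I2) auto
  then show ?thesis
    using finite_measure.integrable_const_bound[OF finite_measures[OF j]]
      borel_measurable_continuous[OF j h] by blast
qed

lemma integrable_potential: "potentials f \<Longrightarrow> j \<in> {1..N} \<Longrightarrow> integrable (\<mu> j) (f j)"
  by (rule integrable_continuous) (auto simp: potentials_def)

definition dual_value :: "(nat \<Rightarrow> 'a \<Rightarrow> real) \<Rightarrow> real" where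
  "dual_value f = (\<Sum>j=1..N. LINT x|\<mu> j. f j x)"

lemma dual_value_mono:
  assumes "potentials f" "potentials g"
    and "\<And>j x. j \<in> {1..N} \<Longrightarrow> x \<in> mspace (X j) \<Longrightarrow> f j x \<le> g j x"
  shows "dual_value f \<le> dual_value g"
  unfolding dual_value_def
proof (rule sum_mono)
  fix j assume j: "j \<in> {1..N}"
  show "(LINT x|\<mu> j. f j x) \<le> (LINT x|\<mu> j. g j x)"
    using integrable_potential[OF _ j] assms j space_\<mu>[OF j] by (intro integral_mono) auto
qed

lemma sum_split_one:
  fixes a :: "nat \<Rightarrow> real"
  shows "(\<Sum>i=1..N. a i) = a 1 + (\<Sum>i=2..N. a i)"
  using sum.remove[of "{1..N}" 1 a] one_in by (simp only: without_one finite_atLeastAtMost)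

text \<open>
  For fixed \<open>B\<close> these tuples are uniformly bounded, equicontinuous and closed under pointwise limits,
  which is the compactness behind the existence of a maximizer.
\<close>

definition normalized :: "real \<Rightarrow> (nat \<Rightarrow> 'a \<Rightarrow> real) \<Rightarrow> bool" where
  "normalized B g \<longleftrightarrow> admissible g \<and>
    (\<forall>j\<in>{1..N}. \<forall>x\<in>mspace (X j). \<bar>g j x\<bar> \<le> B) \<and>
    (\<forall>j\<in>{1..N}. \<forall>x\<in>mspace (X j). \<forall>y\<in>mspace (X j). \<bar>g j x - g j y\<bar> \<le> K * mdist (X j) x y)"

lemma normalized_potentials: "normalized B g \<Longrightarrow> potentials g"
  unfolding normalized_def potentials_def by (intro ballI lipschitz_imp_continuous_map) blast

lemma cost_bounded:
  obtains C where "0 \<le> C" "\<And>y. y \<in> prod_space X {1..N} \<Longrightarrow> \<bar>c y\<bar> \<le> C"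
proof -
  have "continuous_map (product_top {1..N}) euclideanreal c"
    by (rule continuous_map_summed_lipschitz[OF _ lipschitz]) auto
  from continuous_map_bounded[OF compact_product_top this] that show thesis
    unfolding topspace_product_top by blast
qed

lemma distance_bounded:
  assumes "\<And>j. j \<in> {1..N} \<Longrightarrow> p j \<in> mspace (X j)"
  obtains D where "0 \<le> D" "\<And>j x. j \<in> {1..N} \<Longrightarrow> x \<in> mspace (X j) \<Longrightarrow> mdist (X j) x (p j) \<le> D"
proof -
  have "\<exists>b\<ge>0. \<forall>x\<in>mspace (X j). mdist (X j) x (p j) \<le> b" if j: "j \<in> {1..N}" for j
  proof -
    have "continuous_map (mtopology_of (X j)) euclideanreal (mdist (X j) (p j))"
      using assms[OF j] by (simp add: continuous_map_mdist)
    then obtain b where "0 \<le> b" "\<And>x. x \<in> mspace (X j) \<Longrightarrow> \<bar>mdist (X j) (p j) x\<bar> \<le> b"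
      using continuous_map_bounded[OF compact[OF j]] by (metis topspace_mtopology_of)
    then show ?thesis by (auto simp: mdist_commute[of "X j" _ "p j"])
  qed
  then obtain b where b: "\<And>j. j \<in> {1..N} \<Longrightarrow> 0 \<le> b j"
      "\<And>j x. j \<in> {1..N} \<Longrightarrow> x \<in> mspace (X j) \<Longrightarrow> mdist (X j) x (p j) \<le> b j"
    by metis
  show thesis
  proof (rule that[of "\<Sum>j=1..N. b j"])
    show "0 \<le> (\<Sum>j=1..N. b j)" using b(1) by (intro sum_nonneg) auto
    show "mdist (X j) x (p j) \<le> (\<Sum>j=1..N. b j)" if "j \<in> {1..N}" "x \<in> mspace (X j)" for j x
      using b(2)[OF that] member_le_sum[of j "{1..N}" b] b(1) that(1) by fastforce
  qed
qed

text \<open>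
  A conjugate tuple is pinned to the value zero at a base point \<open>p\<^sub>j\<close> for each \<open>j \<ge> 2\<close>, at the expense of the
  first component. The Lipschitz constant then bounds the components \<open>j \<ge> 2\<close>, and the contact equation
  \<open>f\<^sub>1(x) + f\<^sub>2(z\<^sub>2) + \<dots> + f\<^sub>N(z\<^sub>N) = c(x, z)\<close> at a minimizing point bounds the first one. The dual value is
  unchanged because the constants add up to zero and all measures have the same mass.
\<close>

lemma normalization:
  obtains B where "\<And>f. potentials f \<Longrightarrow> admissible f \<Longrightarrow> \<exists>g. normalized B g \<and> dual_value f \<le> dual_value g"
proof -
  obtain C where C: "0 \<le> C" "\<And>y. y \<in> prod_space X {1..N} \<Longrightarrow> \<bar>c y\<bar> \<le> C"
    by (rule cost_bounded) blast
  define p where "p = (\<lambda>j. SOME x. x \<in> mspace (X j))"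
  have p: "p j \<in> mspace (X j)" if "j \<in> {1..N}" for j
    using nonempty[OF that] unfolding p_def by (simp add: some_in_eq)
  obtain D where D: "0 \<le> D" "\<And>j x. j \<in> {1..N} \<Longrightarrow> x \<in> mspace (X j) \<Longrightarrow> mdist (X j) x (p j) \<le> D"
    by (rule distance_bounded[of p, OF p]) auto
  define B where "B = C + real N * (K * D)"
  have KD: "0 \<le> K * D" using K_pos D(1) by simp
  have "K * D \<le> real N * (K * D)" using KD two_le by (simp add: mult_le_cancel_right1)
  then have KDB: "K * D \<le> B" using C(1) by (simp add: B_def)
  show thesis
  proof (rule that[of B])
    fix f assume f: "potentials f" "admissible f"
    obtain g where g: "potentials g" "admissible g" "c_conjugate N X c g"
        and fg: "\<And>j x. j \<in> {1..N} \<Longrightarrow> x \<in> mspace (X j) \<Longrightarrow> f j x \<le> g j x"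
      by (rule conjugate_improvement[OF f]) blast
    define a where "a = (\<lambda>j. if j = 1 then (\<Sum>k=2..N. g k (p k)) else - g j (p j))"
    have a0: "(\<Sum>j=1..N. a j) = 0"
    proof -
      have "(\<Sum>j=2..N. a j) = (\<Sum>j=2..N. - g j (p j))"
        by (intro sum.cong) (auto simp: a_def)
      then show ?thesis by (subst sum_split_one) (simp add: a_def sum_negf)
    qed
    define g' where "g' = (\<lambda>j x. g j x + a j)"
    have sum_g': "(\<Sum>i=1..N. g' i (y i)) = (\<Sum>i=1..N. g i (y i))" for y
      using a0 by (simp add: g'_def sum.distrib)
    have lip: "\<bar>g' j x - g' j y\<bar> \<le> K * mdist (X j) x y"
      if j: "j \<in> {1..N}" and x: "x \<in> mspace (X j)" and y: "y \<in> mspace (X j)" for j x y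
      using g(3) j x y c_transform_lipschitz[OF g(1) j x y] by (simp add: c_conjugate_def g'_def)
    have small: "\<bar>g' j x\<bar> \<le> K * D" if j: "j \<in> {2..N}" and x: "x \<in> mspace (X j)" for j x
    proof -
      have j1: "j \<in> {1..N}" using j by auto
      have "g' j (p j) = 0" using j by (auto simp: g'_def a_def)
      then have "\<bar>g' j x\<bar> \<le> K * mdist (X j) x (p j)"
        using lip[OF j1 x p[OF j1]] by simp
      also have "\<dots> \<le> K * D" using D(2)[OF j1 x] K_pos by simp
      finally show ?thesis .
    qed
    have first: "\<bar>g' 1 x\<bar> \<le> B" if x: "x \<in> mspace (X 1)" for x
    proof -
      obtain z where z: "z \<in> prod_space X {2..N}" "g 1 x + (\<Sum>k=2..N. g k (z k)) = c (z(1 := x))"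
        using c_normal_nonempty[OF g(1,3) x] unfolding c_normal_def by blast
      have zx: "z(1 := x) \<in> prod_space X {1..N}"
        using prod_space_update[OF one_in x] z(1) unfolding without_one by blast
      have "(\<Sum>i=1..N. g' i ((z(1 := x)) i)) = (\<Sum>i=1..N. g i ((z(1 := x)) i))" by (rule sum_g')
      then have eq: "g' 1 x = c (z(1 := x)) - (\<Sum>k=2..N. g' k (z k))"
        using z(2) unfolding sum_update[OF one_in] without_one by linarith
      have "\<bar>\<Sum>k=2..N. g' k (z k)\<bar> \<le> (\<Sum>k=2..N. \<bar>g' k (z k)\<bar>)" by (rule sum_abs)
      also have "\<dots> \<le> real (card {2..N}) * (K * D)"
      proof (rule sum_bounded_above)
        fix k assume k: "k \<in> {2..N}"
        then have "z k \<in> mspace (X k)" using prod_space_coordinate[OF z(1)] by blast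
        then show "\<bar>g' k (z k)\<bar> \<le> K * D" by (rule small[OF k])
      qed
      also have "\<dots> \<le> real N * (K * D)" using KD by (intro mult_right_mono) auto
      finally show ?thesis using eq C(2)[OF zx] unfolding B_def by linarith
    qed
    have "admissible g'" using g(2) unfolding admissible_def sum_g' .
    moreover have "\<bar>g' j x\<bar> \<le> B" if "j \<in> {1..N}" "x \<in> mspace (X j)" for j x
    proof (cases "j = 1")
      case True
      then show ?thesis using first that by simp
    next
      case False
      then have "j \<in> {2..N}" using that by auto
      from small[OF this that(2)] KDB show ?thesis by linarith
    qed
    ultimately have "normalized B g'" using lip unfolding normalized_def by blast
    moreover have "dual_value g' = dual_value g"
    proof -
      have "dual_value g' = (\<Sum>j=1..N. (LINT x|\<mu> j. g j x) + mass * a j)"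
        unfolding dual_value_def
      proof (rule sum.cong[OF refl])
        fix j assume j: "j \<in> {1..N}"
        interpret finite_measure "\<mu> j" by (rule finite_measures[OF j])
        show "(LINT x|\<mu> j. g' j x) = (LINT x|\<mu> j. g j x) + mass * a j"
          using integrable_potential[OF g(1) j] by (simp add: g'_def measure_space_\<mu>[OF j])
      qed
      also have "\<dots> = dual_value g + mass * (\<Sum>j=1..N. a j)"
        by (simp add: dual_value_def sum.distrib sum_distrib_left)
      finally show ?thesis unfolding a0 by simp
    qed
    moreover have "dual_value f \<le> dual_value g" by (rule dual_value_mono[OF f(1) g(1) fg])
    ultimately show "\<exists>g. normalized B g \<and> dual_value f \<le> dual_value g" by metis
  qed
qed

text \<open>
  Arzela-Ascoli in pointwise form: a diagonal subsequence converges on countable dense subsets of all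
  the spaces at once, and equicontinuity extends the convergence to every point.
\<close>

lemma normalized_convergent_subsequence:
  assumes g: "\<And>n. normalized B (g n)"
  obtains f and k :: "nat \<Rightarrow> nat" where "strict_mono k"
    "\<And>j x. j \<in> {1..N} \<Longrightarrow> x \<in> mspace (X j) \<Longrightarrow> (\<lambda>n. g (k n) j x) \<longlonglongrightarrow> f j x"
proof -
  have bound: "\<bar>g n j x\<bar> \<le> B" and lip: "\<bar>g n j x - g n j y\<bar> \<le> K * mdist (X j) x y"
    if "j \<in> {1..N}" "x \<in> mspace (X j)" "y \<in> mspace (X j)" for n j x y
    using g[of n] that unfolding normalized_def by blast+
  have "\<exists>Q. countable Q \<and> Q \<subseteq> mspace (X j) \<and>
      (\<forall>x e. x \<in> mspace (X j) \<longrightarrow> e > 0 \<longrightarrow> (\<exists>q\<in>Q. mdist (X j) x q < e))" if "j \<in> {1..N}" for j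
    using compact_metric_countable_dense[OF compact[OF that]] by metis
  then obtain Q where Q: "\<And>j. j \<in> {1..N} \<Longrightarrow> countable (Q j)"
      "\<And>j. j \<in> {1..N} \<Longrightarrow> Q j \<subseteq> mspace (X j)"
      "\<And>j x e. j \<in> {1..N} \<Longrightarrow> x \<in> mspace (X j) \<Longrightarrow> e > 0 \<Longrightarrow> \<exists>q\<in>Q j. mdist (X j) x q < e"
    by metis
  obtain k :: "nat \<Rightarrow> nat" where k: "strict_mono k"
      "\<And>r. r \<in> Sigma {1..N} Q \<Longrightarrow> \<exists>l. (\<lambda>n. (\<lambda>n (j, x). g n j x) (k n) r) \<longlonglongrightarrow> l"
  proof (rule function_convergent_subsequence[of "Sigma {1..N} Q" "\<lambda>n (j, x). g n j x" B])
    show "countable (Sigma {1..N} Q)" using Q(1) by (intro countable_SIGMA) auto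
    show "norm (case r of (j, x) \<Rightarrow> g n j x) \<le> B" if rQ: "r \<in> Sigma {1..N} Q" for n r
    proof -
      obtain j x where r: "r = (j, x)" "j \<in> {1..N}" "x \<in> Q j" using rQ by blast
      have "x \<in> mspace (X j)" using Q(2)[OF r(2)] r(3) by blast
      from bound[OF r(2) this this] show ?thesis by (simp add: r(1))
    qed
  qed blast
  have "convergent (\<lambda>n. g (k n) j x)" if j: "j \<in> {1..N}" and x: "x \<in> mspace (X j)" for j x
  proof -
    \<comment> \<open>three epsilon argument through a nearby point of the dense set\<close>
    have "Cauchy (\<lambda>n. g (k n) j x)"
    proof (rule metric_CauchyI)
      fix e :: real assume e: "e > 0"
      then have "e / (3 * K) > 0" using K_pos by simp
      then obtain q where q: "q \<in> Q j" "mdist (X j) x q < e / (3 * K)"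
        using Q(3)[OF j x] by blast
      have q': "q \<in> mspace (X j)" using q(1) Q(2)[OF j] by auto
      have "Cauchy (\<lambda>n. g (k n) j q)"
        using k(2)[of "(j, q)"] j q(1) by (auto intro: LIMSEQ_imp_Cauchy)
      then obtain M where M: "\<And>m n. m \<ge> M \<Longrightarrow> n \<ge> M \<Longrightarrow> dist (g (k m) j q) (g (k n) j q) < e / 3"
        using e unfolding Cauchy_def by (metis divide_pos_pos zero_less_numeral)
      have near: "\<bar>g n j x - g n j q\<bar> < e / 3" for n
      proof -
        have "K * mdist (X j) x q < e / 3" using q(2) K_pos by (simp add: field_simps)
        then show ?thesis using lip[OF j x q', of n] by linarith
      qed
      have "dist (g (k m) j x) (g (k n) j x) < e" if "m \<ge> M" "n \<ge> M" for m n
        using M[OF that] near[of "k m"] near[of "k n"] unfolding dist_real_def by linarith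
      then show "\<exists>M. \<forall>m\<ge>M. \<forall>n\<ge>M. dist (g (k m) j x) (g (k n) j x) < e" by blast
    qed
    then show ?thesis by (simp add: Cauchy_convergent_iff)
  qed
  then have "(\<lambda>n. g (k n) j x) \<longlonglongrightarrow> lim (\<lambda>n. g (k n) j x)" if "j \<in> {1..N}" "x \<in> mspace (X j)" for j x
    using that convergent_LIMSEQ_iff by blast
  then show thesis by (rule that[OF k(1)])
qed

lemma normalized_limit:
  assumes g: "\<And>n. normalized B (g n)"
    and lim: "\<And>j x. j \<in> {1..N} \<Longrightarrow> x \<in> mspace (X j) \<Longrightarrow> (\<lambda>n. g n j x) \<longlonglongrightarrow> f j x"
  shows "normalized B f" and "(\<lambda>n. dual_value (g n)) \<longlonglongrightarrow> dual_value f"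
proof -
  have bound: "\<bar>g n j x\<bar> \<le> B" and lip: "\<bar>g n j x - g n j y\<bar> \<le> K * mdist (X j) x y"
    if "j \<in> {1..N}" "x \<in> mspace (X j)" "y \<in> mspace (X j)" for n j x y
    using g[of n] that unfolding normalized_def by blast+
  have adm: "(\<Sum>i=1..N. g n i (y i)) \<le> c y" if "y \<in> prod_space X {1..N}" for n y
    using g[of n] that unfolding normalized_def admissible_def by blast
  show norm: "normalized B f"
    unfolding normalized_def admissible_def
  proof (intro conjI ballI)
    fix y assume y: "y \<in> prod_space X {1..N}"
    have "(\<lambda>n. \<Sum>i=1..N. g n i (y i)) \<longlonglongrightarrow> (\<Sum>i=1..N. f i (y i))"
      by (intro tendsto_sum lim) (simp_all add: prod_space_coordinate[OF y])
    then show "(\<Sum>i=1..N. f i (y i)) \<le> c y"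
      by (rule LIMSEQ_le_const2) (use adm[OF y] in auto)
  next
    fix j x assume jx: "j \<in> {1..N}" "x \<in> mspace (X j)"
    show "\<bar>f j x\<bar> \<le> B"
      by (rule LIMSEQ_le_const2[OF tendsto_rabs[OF lim[OF jx]]]) (use bound[OF jx jx(2)] in auto)
    fix y assume y: "y \<in> mspace (X j)"
    show "\<bar>f j x - f j y\<bar> \<le> K * mdist (X j) x y"
      by (rule LIMSEQ_le_const2[OF tendsto_rabs[OF tendsto_diff[OF lim[OF jx] lim[OF jx(1) y]]]])
        (use lip[OF jx y] in auto)
  qed
  show "(\<lambda>n. dual_value (g n)) \<longlonglongrightarrow> dual_value f"
    unfolding dual_value_def
  proof (rule tendsto_sum)
    fix j assume j: "j \<in> {1..N}"
    interpret finite_measure "\<mu> j" by (rule finite_measures[OF j])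
    show "(\<lambda>n. LINT x|\<mu> j. g n j x) \<longlonglongrightarrow> (LINT x|\<mu> j. f j x)"
    proof (rule integral_dominated_convergence[where w = "\<lambda>_. B"])
      show "f j \<in> borel_measurable (\<mu> j)" "g n j \<in> borel_measurable (\<mu> j)" for n
        using integrable_potential[OF normalized_potentials[OF norm] j]
          integrable_potential[OF normalized_potentials[OF g] j] by auto
      show "AE x in \<mu> j. (\<lambda>n. g n j x) \<longlonglongrightarrow> f j x"
        using lim[OF j] space_\<mu>[OF j] by (intro AE_I2) auto
      show "AE x in \<mu> j. norm (g n j x) \<le> B" for n
        using bound[OF j] space_\<mu>[OF j] by (intro AE_I2) auto
    qed simp
  qed
qed

text \<open>
  A limit of a maximizing sequence of normalized tuples has maximal dual value. It is made conjugate
  afterwards, which cannot lower the dual value.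
\<close>

lemma dual_maximizer:
  obtains f where "potentials f" "c_conjugate N X c f"
    "\<And>g. potentials g \<Longrightarrow> admissible g \<Longrightarrow> dual_value g \<le> dual_value f"
proof -
  obtain B where B: "\<And>f. potentials f \<Longrightarrow> admissible f \<Longrightarrow> \<exists>g. normalized B g \<and> dual_value f \<le> dual_value g"
    by (rule normalization) blast
  define V where "V = dual_value ` {g. normalized B g}"
  let ?z = "\<lambda>_ _. 0 :: real"
  have z: "potentials ?z" by (simp add: potentials_def)
  have "\<exists>g. normalized B g"
    using B[OF potentials_update_transform[OF z one_in] admissible_update_transform[OF z one_in]] by blast
  then have V0: "V \<noteq> {}" by (auto simp: V_def)
  have "dual_value g \<le> real N * (mass * B)" if g: "normalized B g" for g
  proof -
    have "(LINT x|\<mu> j. g j x) \<le> mass * B" if j: "j \<in> {1..N}" for j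
    proof -
      interpret finite_measure "\<mu> j" by (rule finite_measures[OF j])
      have "(LINT x|\<mu> j. g j x) \<le> (LINT x|\<mu> j. B)"
      proof (rule integral_mono)
        show "g j x \<le> B" if "x \<in> space (\<mu> j)" for x
          using g that j unfolding normalized_def space_\<mu>[OF j] by (meson abs_le_D1)
      qed (use integrable_potential[OF normalized_potentials[OF g] j] in auto)
      then show ?thesis by (simp add: measure_space_\<mu>[OF j])
    qed
    then have "dual_value g \<le> (\<Sum>j=1..N. mass * B)" unfolding dual_value_def by (rule sum_mono)
    then show ?thesis by simp
  qed
  then have bdd: "bdd_above V" unfolding V_def by (intro bdd_aboveI) auto
  have "\<exists>g. normalized B g \<and> Sup V - 1 / real (Suc n) < dual_value g" for n
  proof -
    have "Sup V - 1 / real (Suc n) < Sup V" by simp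
    then obtain v where "v \<in> V" "Sup V - 1 / real (Suc n) < v"
      using less_cSup_iff[OF V0 bdd] by blast
    then show ?thesis unfolding V_def by blast
  qed
  then obtain g where g: "\<And>n. normalized B (g n)" "\<And>n. Sup V - 1 / real (Suc n) < dual_value (g n)"
    by metis
  obtain f k where k: "strict_mono (k :: nat \<Rightarrow> nat)"
      and lim: "\<And>j x. j \<in> {1..N} \<Longrightarrow> x \<in> mspace (X j) \<Longrightarrow> (\<lambda>n. g (k n) j x) \<longlonglongrightarrow> f j x"
    by (rule normalized_convergent_subsequence[of B g, OF g(1)]) blast
  have f: "normalized B f" and "(\<lambda>n. dual_value (g (k n))) \<longlonglongrightarrow> dual_value f"
    using normalized_limit[of B "\<lambda>n. g (k n)" f, OF g(1) lim] by auto
  moreover have "(\<lambda>n. Sup V - 1 / real (Suc n)) \<longlonglongrightarrow> Sup V - 0"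
    using LIMSEQ_inverse_real_of_nat by (intro tendsto_diff tendsto_const) (simp add: inverse_eq_divide)
  then have "(\<lambda>n. Sup V - 1 / real (Suc (k n))) \<longlonglongrightarrow> Sup V"
    using LIMSEQ_subseq_LIMSEQ[OF _ k] by (force simp: o_def)
  ultimately have "Sup V \<le> dual_value f"
    using g(2) by (meson LIMSEQ_le less_imp_le)
  moreover have pf: "potentials f" "admissible f"
    using normalized_potentials[OF f] f unfolding normalized_def by auto
  obtain f' where f': "potentials f'" "admissible f'" "c_conjugate N X c f'"
      "\<And>j x. j \<in> {1..N} \<Longrightarrow> x \<in> mspace (X j) \<Longrightarrow> f j x \<le> f' j x"
    by (rule conjugate_improvement[OF pf]) blast
  have "dual_value g \<le> dual_value f'" if g: "potentials g" "admissible g" for g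
  proof -
    obtain g' where g': "normalized B g'" "dual_value g \<le> dual_value g'" using B[OF g] by blast
    have "dual_value g' \<le> Sup V" by (rule cSup_upper[OF _ bdd]) (use g'(1) in \<open>auto simp: V_def\<close>)
    then show ?thesis
      using g'(2) \<open>Sup V \<le> dual_value f\<close> dual_value_mono[OF pf(1) f'(1) f'(4)] by linarith
  qed
  then show thesis using that f' by blast
qed

end



section \<open>Measurability modulo null sets and open sets as cozero sets\<close>

text \<open>
  Over a complete measure, measurability passes to any function that agrees almost everywhere. This
  is how selectors of multivalued maps, which are pinned down only almost everywhere, become measurable.
\<close>

lemma (in complete_measure) measurable_AE_eq:
  assumes f: "f \<in> M \<rightarrow>\<^sub>M N" and eq: "AE x in M. f x = g x"
    and g: "\<And>x. x \<in> space M \<Longrightarrow> g x \<in> space N"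
  shows "g \<in> M \<rightarrow>\<^sub>M N"
proof (rule measurableI)
  fix A assume A: "A \<in> sets N"
  show "g -` A \<inter> space M \<in> sets M"
  proof (rule in_sets_AE)
    show "f -` A \<inter> space M \<in> sets M" using f A by (rule measurable_sets)
    show "AE x in M. (x \<in> f -` A \<inter> space M) = (x \<in> g -` A \<inter> space M)"
      using eq by eventually_elim auto
  qed auto
qed (use g in auto)

text \<open>
  The function is the distance to the complement, or a constant if the complement is empty.
\<close>

lemma open_set_cozero:
  assumes U: "openin (mtopology_of m) U"
  obtains d :: "'a \<Rightarrow> real" where "continuous_map (mtopology_of m) euclideanreal d"
    "\<And>y. 0 \<le> d y" "\<And>y. y \<in> mspace m \<Longrightarrow> 0 < d y \<longleftrightarrow> y \<in> U"
proof (cases "U = mspace m")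
  case True
  then show thesis using that[of "\<lambda>_. 1"] by simp
next
  case False
  define F where "F = mspace m - U"
  have sub: "U \<subseteq> mspace m" using openin_subset[OF U] by simp
  have F: "F \<noteq> {}" using False sub by (auto simp: F_def)
  define d where "d = (\<lambda>y. INF e\<in>F. mdist m y e)"
  have bdd: "bdd_below (mdist m y ` F)" for y
    by (rule bdd_belowI2[of _ 0]) simp
  have d_le: "d y \<le> mdist m y e" if "e \<in> F" for y e
    unfolding d_def by (rule cINF_lower[OF bdd that])
  have d0: "0 \<le> d y" for y
    unfolding d_def by (rule cINF_greatest[OF F]) simp
  have tri: "d x \<le> d y + mdist m x y" if x: "x \<in> mspace m" and y: "y \<in> mspace m" for x y
  proof -
    have "d x - mdist m x y \<le> (INF e\<in>F. mdist m y e)"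
    proof (rule cINF_greatest[OF F])
      fix e assume e: "e \<in> F"
      then have "mdist m x e \<le> mdist m x y + mdist m y e"
        using x y by (intro mdist_triangle) (auto simp: F_def)
      then show "d x - mdist m x y \<le> mdist m y e" using d_le[OF e, of x] by linarith
    qed
    then show ?thesis unfolding d_def[THEN fun_cong, of y] by linarith
  qed
  have "\<bar>d x - d y\<bar> \<le> 1 * mdist m x y" if "x \<in> mspace m" "y \<in> mspace m" for x y
    using tri[OF that] tri[OF that(2,1)] mdist_commute[of m x y] by linarith
  then have "continuous_map (mtopology_of m) euclideanreal d"
    by (rule lipschitz_imp_continuous_map)
  moreover have "0 < d y \<longleftrightarrow> y \<in> U" if y: "y \<in> mspace m" for y
  proof
    assume "y \<in> U"
    then obtain r where r: "r > 0" "Metric_space.mball (mspace m) (mdist m) y r \<subseteq> U"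
      using U Metric_space.openin_mtopology[OF Metric_space_mspace_mdist, of m U]
      unfolding mtopology_of_def by blast
    have "r \<le> d y"
      unfolding d_def
    proof (rule cINF_greatest[OF F])
      fix e assume e: "e \<in> F"
      show "r \<le> mdist m y e"
      proof (rule ccontr)
        assume "\<not> r \<le> mdist m y e"
        then have "e \<in> Metric_space.mball (mspace m) (mdist m) y r"
          using e y Metric_space.in_mball[OF Metric_space_mspace_mdist, of e m y r]
          by (auto simp: F_def)
        then show False using r(2) e by (auto simp: F_def)
      qed
    qed
    then show "0 < d y" using r(1) by linarith
  next
    assume "0 < d y"
    show "y \<in> U"
    proof (rule ccontr)
      assume "y \<notin> U"
      then have "d y \<le> mdist m y y" using y by (intro d_le) (simp add: F_def)
      then show False using \<open>0 < d y\<close> mdist_zero[OF y y] by simp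
    qed
  qed
  ultimately show thesis using that d0 by blast
qed

lemma cozero_indicator_limit:
  fixes t :: real
  assumes "0 \<le> t"
  shows "(\<lambda>n. min 1 (real n * t)) \<longlonglongrightarrow> (if 0 < t then 1 else 0)"
proof (cases "t = 0")
  case False
  then have t: "t > 0" using assms by simp
  obtain M where M: "1 / t \<le> real M" using real_arch_simple by blast
  have "min 1 (real n * t) = 1" if "n \<ge> M" for n
  proof -
    have "1 / t \<le> real n" using M that by linarith
    then show ?thesis using t by (simp add: field_simps)
  qed
  then have "\<forall>\<^sub>F n in sequentially. min 1 (real n * t) = 1"
    unfolding eventually_sequentially by blast
  then show ?thesis using t by (simp add: tendsto_eventually)
qed simp

text \<open>
  Measurability and the image measure of \<open>u\<close> are both detected by continuous test functions \<open>h\<close> on the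
  target: an open set is the cozero set of some \<open>d\<close>, and its indicator is the limit of the bounded
  continuous functions \<open>min 1 (n d)\<close>. Finite measures that agree on open sets are equal.
\<close>

lemma distr_eqI_continuous:
  fixes u :: "'b \<Rightarrow> 'a"
  assumes M: "finite_measure M" and L: "finite_measure L"
    and sets_L: "sets L = sets (borel_of (mtopology_of m))"
    and u: "\<And>x. x \<in> space M \<Longrightarrow> u x \<in> mspace m"
    and meas: "\<And>h :: 'a \<Rightarrow> real. continuous_map (mtopology_of m) euclideanreal h \<Longrightarrow>
      (\<lambda>x. h (u x)) \<in> borel_measurable M"
    and int: "\<And>h :: 'a \<Rightarrow> real. continuous_map (mtopology_of m) euclideanreal h \<Longrightarrow>
      (LINT x|M. h (u x)) = (LINT y|L. h y)"
  shows "u \<in> M \<rightarrow>\<^sub>M L" and "distr M L u = L"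
proof -
  interpret M: finite_measure M by fact
  interpret L: finite_measure L by fact
  let ?T = "mtopology_of m"
  have sp: "space L = mspace m"
    using sets_eq_imp_space_eq[OF sets_L] by (simp add: space_borel_of)
  have gen: "sets L = sigma_sets (mspace m) {U. openin ?T U}"
    using sets_L by (simp add: borel_of_sets)
  have pow: "{U. openin ?T U} \<subseteq> Pow (mspace m)"
    using openin_subset[of ?T] by auto
  show meas_u: "u \<in> M \<rightarrow>\<^sub>M L"
  proof (rule measurable_sigma_sets[OF gen pow])
    show "u \<in> space M \<rightarrow> mspace m" using u by auto
    fix U assume "U \<in> {U. openin ?T U}"
    then have "openin ?T U" by simp
    then obtain d :: "'a \<Rightarrow> real" where d: "continuous_map ?T euclideanreal d"
        "\<And>y. y \<in> mspace m \<Longrightarrow> 0 < d y \<longleftrightarrow> y \<in> U"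
      by (rule open_set_cozero) blast
    have "u -` U \<inter> space M = (\<lambda>x. d (u x)) -` {0<..} \<inter> space M"
      using u d(2) by auto
    also have "\<dots> \<in> sets M" by (rule measurable_sets[OF meas[OF d(1)]]) simp
    finally show "u -` U \<inter> space M \<in> sets M" .
  qed
  have open_eq: "emeasure (distr M L u) U = emeasure L U" if U: "openin ?T U" for U
  proof -
    obtain d :: "'a \<Rightarrow> real" where d: "continuous_map ?T euclideanreal d" "\<And>y. 0 \<le> d y"
        "\<And>y. y \<in> mspace m \<Longrightarrow> 0 < d y \<longleftrightarrow> y \<in> U"
      by (rule open_set_cozero[OF U]) blast
    have UL: "U \<in> sets L" using U by (simp add: gen sigma_sets.Basic)
    define h where "h = (\<lambda>n y. min 1 (real n * d y))"
    have h: "continuous_map ?T euclideanreal (h n)" for n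
      unfolding h_def by (intro continuous_map_real_min continuous_map_real_mult_left d(1)) simp
    have hb: "norm (h n y) \<le> 1" for n y
      using d(2)[of y] by (simp add: h_def)
    have hlim: "(\<lambda>n. h n y) \<longlonglongrightarrow> indicator U y" if "y \<in> mspace m" for y
      using cozero_indicator_limit[OF d(2)[of y]] d(3)[OF that] by (simp add: h_def indicator_def split: if_splits)
    have "(\<lambda>n. LINT y|L. h n y) \<longlonglongrightarrow> (LINT y|L. indicator U y)"
    proof (rule integral_dominated_convergence[where w = "\<lambda>_. 1"])
      show "h n \<in> borel_measurable L" for n
        by (rule borel_measurable_continuous_map[OF h sets_L])
    qed (use UL hb hlim sp in auto)
    moreover have "(\<lambda>n. LINT x|M. h n (u x)) \<longlonglongrightarrow> (LINT x|M. indicator U (u x))"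
    proof (rule integral_dominated_convergence[where w = "\<lambda>_. 1"])
      show "(\<lambda>x. h n (u x)) \<in> borel_measurable M" for n by (rule meas[OF h])
      show "(\<lambda>x. indicator U (u x) :: real) \<in> borel_measurable M"
        using UL meas_u by measurable
    qed (use hb hlim u in auto)
    then have "(\<lambda>n. LINT y|L. h n y) \<longlonglongrightarrow> (LINT x|M. indicator U (u x))"
      by (simp only: int[OF h])
    ultimately have "(LINT x|M. indicator U (u x)) = (LINT y|L. indicator U y :: real)"
      by (rule LIMSEQ_unique[rotated])
    moreover have "(LINT x|M. indicator U (u x) :: real) = (LINT y|distr M L u. indicator U y)"
      by (rule integral_distr[symmetric, OF meas_u]) (use UL in simp)
    ultimately have "measure (distr M L u) U = measure L U"
      using UL by simp
    then show ?thesis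
      using finite_measure.emeasure_eq_measure[OF M.finite_measure_distr[OF meas_u]]
      by (simp add: L.emeasure_eq_measure)
  qed
  show "distr M L u = L"
  proof (rule measure_eqI_generator_eq[where E = "{U. openin ?T U}" and \<Omega> = "mspace m" and A = "\<lambda>_. mspace m"])
    show "Int_stable {U. openin ?T U}" unfolding Int_stable_def by blast
    show "emeasure (distr M L u) (mspace m) \<noteq> \<infinity>"
      using finite_measure.emeasure_finite[OF M.finite_measure_distr[OF meas_u]] by simp
    show "range (\<lambda>_. mspace m) \<subseteq> {U. openin ?T U}"
      using openin_topspace[of ?T] by auto
    show "sets (distr M L u) = sigma_sets (mspace m) {U. openin ?T U}"
      unfolding sets_distr by (rule gen)
    show "emeasure (distr M L u) U = emeasure L U" if "U \<in> {U. openin ?T U}" for U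
      using that open_eq by blast
    show "(\<Union>i::nat. mspace m) = mspace m" by simp
  qed (rule pow gen)+
qed

section \<open>Transport maps\<close>

context transport_problem
begin

abbreviation M1 :: "'a measure" where
  "M1 \<equiv> completion (\<mu> 1)"

text \<open>
  The selectors of elements of \<open>class_S\<close>: everywhere defined single-valued maps. Measurability
  refers to the completion of \<open>\<mu>\<^sub>1\<close>, because membership in the class gives no more.
\<close>

definition transport_map :: "('a \<Rightarrow> nat \<Rightarrow> 'a) \<Rightarrow> bool" where
  "transport_map u \<longleftrightarrow> (\<forall>x\<in>mspace (X 1). u x \<in> prod_space X {2..N}) \<and>
    (\<forall>j\<in>{2..N}. (\<lambda>x. u x j) \<in> M1 \<rightarrow>\<^sub>M \<mu> j \<and> distr M1 (\<mu> j) (\<lambda>x. u x j) = \<mu> j)"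

lemma finite_M1: "finite_measure M1"
  using finite_measure.emeasure_finite[OF finite_measures[OF one_in]]
  by (intro finite_measureI) simp

lemma space_M1: "space M1 = mspace (X 1)"
  using space_\<mu>[OF one_in] by simp

lemma transport_map_in: "transport_map u \<Longrightarrow> x \<in> mspace (X 1) \<Longrightarrow> (u x)(1 := x) \<in> prod_space X {1..N}"
  using prod_space_update[OF one_in] unfolding without_one transport_map_def by blast

text \<open>
  A Lipschitz function is the infimum of the cones with slope \<open>K\<close> over a countable dense set. Each cone is a
  sum of functions of a single coordinate, so measurability of \<open>x \<mapsto> c(x, u x)\<close> follows from that of the
  coordinates of \<open>u\<close>, without comparing the product of the Borel \<open>\<sigma>\<close>-algebras with the Borel \<open>\<sigma>\<close>-algebra
  of the product.
\<close>

lemma cost_countable_INF: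
  obtains Q where "countable Q" "Q \<subseteq> prod_space X {1..N}"
    "\<And>y. y \<in> prod_space X {1..N} \<Longrightarrow> c y = (INF q\<in>Q. c q + K * (\<Sum>i=1..N. mdist (X i) (q i) (y i)))"
proof -
  have "\<exists>Q. countable Q \<and> Q \<subseteq> mspace (X j) \<and>
      (\<forall>x e. x \<in> mspace (X j) \<longrightarrow> e > 0 \<longrightarrow> (\<exists>q\<in>Q. mdist (X j) x q < e))" if "j \<in> {1..N}" for j
    using compact_metric_countable_dense[OF compact[OF that]] by metis
  then obtain Q where Q: "\<And>j. j \<in> {1..N} \<Longrightarrow> countable (Q j)"
      "\<And>j. j \<in> {1..N} \<Longrightarrow> Q j \<subseteq> mspace (X j)"
      "\<And>j x e. j \<in> {1..N} \<Longrightarrow> x \<in> mspace (X j) \<Longrightarrow> e > 0 \<Longrightarrow> \<exists>q\<in>Q j. mdist (X j) x q < e"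
    by metis
  define P where "P = (\<Pi>\<^sub>E i\<in>{1..N}. Q i)"
  have sub: "P \<subseteq> prod_space X {1..N}"
    unfolding P_def prod_space_def by (rule PiE_mono) (rule Q(2))
  have "countable P" unfolding P_def by (rule countable_PiE) (use Q(1) in auto)
  moreover have "c y = (INF q\<in>P. c q + K * (\<Sum>i=1..N. mdist (X i) (q i) (y i)))"
    if y: "y \<in> prod_space X {1..N}" for y
  proof -
    let ?F = "\<lambda>q. c q + K * (\<Sum>i=1..N. mdist (X i) (q i) (y i))"
    have low: "c y \<le> ?F q" if "q \<in> P" for q
      using lipschitz[OF subsetD[OF sub that] y] by linarith
    have near: "\<exists>q\<in>P. ?F q \<le> c y + e" if e: "e > 0" for e
    proof -
      \<comment> \<open>with all \<open>N\<close> coordinates within \<open>r\<close>, the cone at \<open>q\<close> exceeds \<open>c y\<close> by at most \<open>2 K N r = e\<close>\<close>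
      define r where "r = e / (2 * K * real N)"
      have r: "r > 0" using e K_pos two_le by (simp add: r_def)
      have "\<exists>q. q \<in> Q i \<and> mdist (X i) (y i) q < r" if i: "i \<in> {1..N}" for i
      proof -
        have "y i \<in> mspace (X i)" by (rule prod_space_coordinate[OF y i])
        then show ?thesis using Q(3)[OF i _ r] by blast
      qed
      then obtain q where q: "\<And>i. i \<in> {1..N} \<Longrightarrow> q i \<in> Q i \<and> mdist (X i) (y i) (q i) < r"
        by metis
      let ?q = "restrict q {1..N}"
      have qP: "?q \<in> P" using q by (auto simp: P_def)
      have "(\<Sum>i=1..N. mdist (X i) (?q i) (y i)) \<le> real (card {1..N}) * r"
      proof (rule sum_bounded_above)
        fix i assume "i \<in> {1..N}"
        then show "mdist (X i) (?q i) (y i) \<le> r"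
          using q[of i] mdist_commute[of "X i" "q i" "y i"] by simp
      qed
      then have "K * (\<Sum>i=1..N. mdist (X i) (?q i) (y i)) \<le> K * (real N * r)"
        using K_pos by simp
      also have "\<dots> = e / 2" using K_pos two_le by (simp add: r_def)
      finally have "K * (\<Sum>i=1..N. mdist (X i) (?q i) (y i)) \<le> e / 2" .
      then have "?F ?q \<le> c y + e"
        using lipschitz[OF subsetD[OF sub qP] y] by linarith
      then show ?thesis using qP by blast
    qed
    have ne: "P \<noteq> {}" using near[of 1] by auto
    have bdd: "bdd_below (?F ` P)" by (rule bdd_belowI2[OF low])
    show ?thesis
    proof (rule antisym)
      show "c y \<le> (INF q\<in>P. ?F q)" by (rule cINF_greatest[OF ne low])
      show "(INF q\<in>P. ?F q) \<le> c y"
      proof (rule field_le_epsilon)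
        fix e :: real assume "e > 0"
        then obtain q where "q \<in> P" "?F q \<le> c y + e" using near by blast
        then show "(INF q\<in>P. ?F q) \<le> c y + e" using cINF_lower[OF bdd] by fastforce
      qed
    qed
  qed
  ultimately show thesis using that sub by blast
qed

lemma transport_map_cost_integrable:
  assumes u: "transport_map u"
  shows "integrable M1 (\<lambda>x. c ((u x)(1 := x)))"
proof -
  interpret finite_measure M1 by (rule finite_M1)
  obtain Q where Q: "countable Q" "Q \<subseteq> prod_space X {1..N}"
      "\<And>y. y \<in> prod_space X {1..N} \<Longrightarrow> c y = (INF q\<in>Q. c q + K * (\<Sum>i=1..N. mdist (X i) (q i) (y i)))"
    by (rule cost_countable_INF) blast
  have coord: "(\<lambda>x. mdist (X i) (q i) (((u x)(1 := x)) i)) \<in> borel_measurable M1"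
    if q: "q \<in> Q" and i: "i \<in> {1..N}" for q i
  proof -
    have "q i \<in> mspace (X i)" using prod_space_coordinate[OF subsetD[OF Q(2) q] i] .
    then have "continuous_map (mtopology_of (X i)) euclideanreal (mdist (X i) (q i))"
      by (simp add: continuous_map_mdist)
    then have d: "mdist (X i) (q i) \<in> borel_measurable (\<mu> i)"
      by (rule borel_measurable_continuous[OF i])
    show ?thesis
    proof (cases "i = 1")
      case True
      then show ?thesis using measurable_completion[OF d] by simp
    next
      case False
      then have "(\<lambda>x. u x i) \<in> M1 \<rightarrow>\<^sub>M \<mu> i" using u i unfolding transport_map_def by auto
      from measurable_compose[OF this d] False show ?thesis by simp
    qed
  qed
  have "(\<lambda>x. INF q\<in>Q. c q + K * (\<Sum>i=1..N. mdist (X i) (q i) (((u x)(1 := x)) i))) \<in> borel_measurable M1"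
    by (intro borel_measurable_cINF_real Q(1) borel_measurable_add borel_measurable_times
        borel_measurable_sum borel_measurable_const coord)
  then have "(\<lambda>x. c ((u x)(1 := x))) \<in> borel_measurable M1"
    by (rule measurable_cong[THEN iffD2, rotated])
      (use Q(3) transport_map_in[OF u] space_M1 in blast)
  moreover obtain C where "\<And>y. y \<in> prod_space X {1..N} \<Longrightarrow> \<bar>c y\<bar> \<le> C"
    by (rule cost_bounded) blast
  then have "AE x in M1. norm (c ((u x)(1 := x))) \<le> C"
    using transport_map_in[OF u] space_M1 by (intro AE_I2) simp
  ultimately show ?thesis by (rule integrable_const_bound[rotated])
qed

lemma transport_map_potential_integral:
  assumes u: "transport_map u" and f: "potentials f"
  shows "integrable M1 (\<lambda>x. f 1 x + (\<Sum>k=2..N. f k (u x k)))"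
    and "(LINT x|M1. f 1 x + (\<Sum>k=2..N. f k (u x k))) = dual_value f"
proof -
  have one: "integrable M1 (f 1)" "(LINT x|M1. f 1 x) = (LINT x|\<mu> 1. f 1 x)"
    using integrable_potential[OF f one_in] by (simp_all add: integrable_completion integral_completion)
  have k: "integrable M1 (\<lambda>x. f k (u x k))" "(LINT x|M1. f k (u x k)) = (LINT y|\<mu> k. f k y)"
    if k: "k \<in> {2..N}" for k
  proof -
    have m: "(\<lambda>x. u x k) \<in> M1 \<rightarrow>\<^sub>M \<mu> k" "distr M1 (\<mu> k) (\<lambda>x. u x k) = \<mu> k"
      using u k unfolding transport_map_def by auto
    have k1: "k \<in> {1..N}" using k by auto
    show "integrable M1 (\<lambda>x. f k (u x k))"
      by (rule integrable_distr[OF m(1)]) (unfold m(2), rule integrable_potential[OF f k1])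
    show "(LINT x|M1. f k (u x k)) = (LINT y|\<mu> k. f k y)"
      using integral_distr[OF m(1), of "f k"] integrable_potential[OF f k1] unfolding m(2) by simp
  qed
  show "integrable M1 (\<lambda>x. f 1 x + (\<Sum>k=2..N. f k (u x k)))"
    by (intro Bochner_Integration.integrable_add Bochner_Integration.integrable_sum one k)
  have "(LINT x|M1. f 1 x + (\<Sum>k=2..N. f k (u x k))) =
      (LINT x|M1. f 1 x) + (LINT x|M1. (\<Sum>k=2..N. f k (u x k)))"
    by (intro Bochner_Integration.integral_add Bochner_Integration.integrable_sum one k)
  also have "(LINT x|M1. (\<Sum>k=2..N. f k (u x k))) = (\<Sum>k=2..N. LINT x|M1. f k (u x k))"
    by (intro Bochner_Integration.integral_sum k)
  also have "\<dots> = (\<Sum>k=2..N. LINT y|\<mu> k. f k y)"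
    by (intro sum.cong refl k(2))
  finally show "(LINT x|M1. f 1 x + (\<Sum>k=2..N. f k (u x k))) = dual_value f"
    unfolding dual_value_def sum_split_one one(2) .
qed

text \<open>
  The equality case of weak duality: the gap between cost and potentials is nonnegative, and its
  integral is the cost of \<open>u\<close> minus the dual value, hence it vanishes almost everywhere.
\<close>

lemma zero_gap_in_c_normal:
  assumes u: "transport_map u" and f: "potentials f" "admissible f"
    and le: "(LINT x|M1. c ((u x)(1 := x))) \<le> dual_value f"
  shows "AE x in M1. u x \<in> c_normal N X c f x"
proof -
  let ?g = "\<lambda>x. c ((u x)(1 := x)) - (f 1 x + (\<Sum>k=2..N. f k (u x k)))"
  have int: "integrable M1 ?g"
    by (intro Bochner_Integration.integrable_diff transport_map_cost_integrable[OF u]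
        transport_map_potential_integral(1)[OF u f(1)])
  have nonneg: "0 \<le> ?g x" if x: "x \<in> mspace (X 1)" for x
  proof -
    have "(\<Sum>i=1..N. f i (((u x)(1 := x)) i)) \<le> c ((u x)(1 := x))"
      using f(2) transport_map_in[OF u x] unfolding admissible_def by blast
    then show ?thesis unfolding sum_update[OF one_in] without_one by linarith
  qed
  then have nn: "AE x in M1. 0 \<le> ?g x" using space_M1 by (intro AE_I2) blast
  have "(LINT x|M1. ?g x) = (LINT x|M1. c ((u x)(1 := x))) - dual_value f"
    using Bochner_Integration.integral_diff[OF transport_map_cost_integrable[OF u]
        transport_map_potential_integral(1)[OF u f(1)]] transport_map_potential_integral(2)[OF u f(1)]
    by simp
  then have "(LINT x|M1. ?g x) = 0"
    using le integral_nonneg_AE[OF nn] by linarith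
  then have "AE x in M1. ?g x = 0"
    using integral_nonneg_eq_0_iff_AE[OF int nn] by blast
  then show ?thesis
  proof (rule AE_mp, intro AE_I2 impI)
    fix x assume "x \<in> space M1" "?g x = 0"
    then show "u x \<in> c_normal N X c f x"
      using u space_M1 unfolding c_normal_def transport_map_def by auto
  qed
qed

section \<open>The c-normal map of a dual maximizer transports the first marginal to the others\<close>

lemma dual_value_update:
  assumes "potentials f" "j \<in> {1..N}"
  shows "dual_value (f(j := h)) = dual_value f + ((LINT x|\<mu> j. h x) - (LINT x|\<mu> j. f j x))"
proof -
  have "(\<Sum>k\<in>{1..N} - {j}. LINT x|\<mu> k. (f(j := h)) k x) = (\<Sum>k\<in>{1..N} - {j}. LINT x|\<mu> k. f k x)"
    by (intro sum.cong) auto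
  then show ?thesis
    unfolding dual_value_def using assms(2) by (simp add: sum.remove[of _ j])
qed

text \<open>
  The perturbed tuple with its first component replaced by the c-transform is admissible, so its dual
  value does not exceed that of \<open>f\<close>. Dividing by the step size \<open>1 / (n + 1)\<close> bounds the integral of \<open>h\<close> by the
  integrals of the difference quotients \<open>q n\<close>, which converge to \<open>h (t x j)\<close>. Being an almost everywhere
  limit of measurable functions, the latter is measurable even though \<open>t\<close> is a mere selector.
\<close>

lemma first_variation:
  assumes f: "potentials f" "c_conjugate N X c f"
    and max: "\<And>g. potentials g \<Longrightarrow> admissible g \<Longrightarrow> dual_value g \<le> dual_value f"
    and single: "AE x in \<mu> 1. c_normal N X c f x = {t x}"
    and j: "j \<in> {2..N}" and h: "continuous_map (mtopology_of (X j)) euclideanreal h"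
  shows "(\<lambda>x. h (t x j)) \<in> borel_measurable M1"
    and "(LINT y|\<mu> j. h y) \<le> (LINT x|M1. h (t x j))"
proof -
  interpret finite_measure M1 by (rule finite_M1)
  have j1: "j \<in> {1..N}" and "j \<noteq> 1" using j by auto
  define p where "p = (\<lambda>n. perturbed f j h n)"
  have p: "potentials (p n)" for n unfolding p_def by (rule potentials_perturbed[OF f(1) j1 h])
  define q where "q = (\<lambda>n x. real (Suc n) * (f 1 x - transform (p n) 1 x))"
  have int_tr: "integrable (\<mu> 1) (transform (p n) 1)" for n
    using integrable_potential[OF potentials_update_transform[OF p one_in] one_in, of n] by simp
  note int_f = integrable_potential[OF f(1) one_in]
  have int_q: "integrable (\<mu> 1) (q n)" for n
    unfolding q_def using int_tr int_f by auto
  then have meas_q: "q n \<in> borel_measurable M1" for n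
    using measurable_completion borel_measurable_integrable by blast
  obtain H where H: "\<And>y. y \<in> mspace (X j) \<Longrightarrow> \<bar>h y\<bar> \<le> H"
    using continuous_map_bounded[OF compact[OF j1] h] by auto
  have bound: "AE x in M1. norm (q n x) \<le> H" for n
    using difference_quotient_bounded[OF f j h H] space_M1
    by (intro AE_I2) (simp add: q_def p_def)
  have lim: "AE x in M1. (\<lambda>n. q n x) \<longlonglongrightarrow> h (t x j)"
    using AE_completion[OF single] AE_space[of M1]
  proof eventually_elim
    case (elim x)
    then show ?case
      using c_transform_derivative[OF f j h, of x "t x"] space_M1 by (simp add: q_def p_def)
  qed
  show meas: "(\<lambda>x. h (t x j)) \<in> borel_measurable M1"
  proof (rule completion.measurable_AE_eq)
    show "(\<lambda>x. lim (\<lambda>n. q n x)) \<in> borel_measurable M1"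
      by (rule borel_measurable_lim_metric[OF meas_q])
    show "AE x in M1. lim (\<lambda>n. q n x) = h (t x j)"
      using lim by eventually_elim (rule limI)
  qed simp
  have conv: "(\<lambda>n. LINT x|M1. q n x) \<longlonglongrightarrow> (LINT x|M1. h (t x j))"
    by (rule integral_dominated_convergence[where w = "\<lambda>_. H", OF meas meas_q integrable_const lim bound])
  have "(LINT y|\<mu> j. h y) \<le> (LINT x|M1. q n x)" for n
  proof -
    have int_h: "integrable (\<mu> j) h" by (rule integrable_continuous[OF j1 h])
    have "dual_value ((p n)(1 := transform (p n) 1)) \<le> dual_value f"
      by (rule max[OF potentials_update_transform[OF p one_in] admissible_update_transform[OF p one_in]])
    moreover have "dual_value ((p n)(1 := transform (p n) 1)) =
        dual_value (p n) + ((LINT x|\<mu> 1. transform (p n) 1 x) - (LINT x|\<mu> 1. p n 1 x))"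
      by (rule dual_value_update[OF p one_in])
    moreover have "p n 1 = f 1" using \<open>j \<noteq> 1\<close> by (simp add: p_def perturbed_def)
    moreover have "dual_value (p n) = dual_value f + (LINT y|\<mu> j. h y) / real (Suc n)"
      unfolding p_def perturbed_def dual_value_update[OF f(1) j1]
      using int_h integrable_potential[OF f(1) j1] by simp
    ultimately have "(LINT y|\<mu> j. h y) / real (Suc n) \<le>
        (LINT x|\<mu> 1. f 1 x) - (LINT x|\<mu> 1. transform (p n) 1 x)"
      by simp
    also have "\<dots> = (LINT x|\<mu> 1. q n x) / real (Suc n)"
      unfolding q_def using int_f int_tr[of n] by simp
    finally have "(LINT y|\<mu> j. h y) \<le> (LINT x|\<mu> 1. q n x)"
      by (simp add: divide_le_cancel)
    then show ?thesis using integral_completion[of "q n" "\<mu> 1"] int_q[of n] by simp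
  qed
  then show "(LINT y|\<mu> j. h y) \<le> (LINT x|M1. h (t x j))"
    by (intro LIMSEQ_le_const[OF conv]) auto
qed

text \<open>
  The inequality of the first variation for \<open>h\<close> and for \<open>- h\<close> is an equality, and continuous test functions
  determine the image measure.
\<close>

lemma c_normal_transport_map:
  assumes f: "potentials f" "c_conjugate N X c f"
    and max: "\<And>g. potentials g \<Longrightarrow> admissible g \<Longrightarrow> dual_value g \<le> dual_value f"
    and t: "\<And>x. x \<in> mspace (X 1) \<Longrightarrow> t x \<in> c_normal N X c f x"
    and single: "AE x in \<mu> 1. c_normal N X c f x = {t x}"
  shows "transport_map t"
proof -
  have tP: "t x \<in> prod_space X {2..N}" if "x \<in> mspace (X 1)" for x
    using t[OF that] unfolding c_normal_def by blast
  have "(\<lambda>x. t x j) \<in> M1 \<rightarrow>\<^sub>M \<mu> j \<and> distr M1 (\<mu> j) (\<lambda>x. t x j) = \<mu> j" if j: "j \<in> {2..N}" for j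
  proof -
    have j1: "j \<in> {1..N}" using j by auto
    have var: "(\<lambda>x. h (t x j)) \<in> borel_measurable M1" "(LINT y|\<mu> j. h y) \<le> (LINT x|M1. h (t x j))"
      if "continuous_map (mtopology_of (X j)) euclideanreal h" for h
      using first_variation[OF f _ single j that] max by blast+
    have eq: "(LINT x|M1. h (t x j)) = (LINT y|\<mu> j. h y)"
      if h: "continuous_map (mtopology_of (X j)) euclideanreal h" for h
    proof -
      have "continuous_map (mtopology_of (X j)) euclideanreal (\<lambda>y. - h y)"
        using h by (rule continuous_map_minus)
      from var(2)[OF this] var(2)[OF h] show ?thesis by simp
    qed
    have in_space: "t x j \<in> mspace (X j)" if "x \<in> space M1" for x
      using prod_space_coordinate[OF tP j] that unfolding space_M1 by blast
    show ?thesis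
      using distr_eqI_continuous[OF finite_M1 finite_measures[OF j1] sets_\<mu>[OF j1] in_space var(1) eq]
      by blast
  qed
  then show ?thesis using tP unfolding transport_map_def by blast
qed

section \<open>Selectors of multivalued measure preserving maps\<close>

text \<open>
  The multivalued preimage of \<open>E\<close> under the \<open>j\<close>-th component of \<open>s\<close> differs from the preimage under the
  selector only where \<open>s\<close> is not single-valued, that is, on a null set.
\<close>

lemma class_S_selector:
  assumes s: "s \<in> class_S N X \<mu>" and u: "\<And>x. x \<in> mspace (X 1) \<Longrightarrow> u x \<in> s x"
  shows "transport_map u" and "AE x in \<mu> 1. s x = {u x}"
proof -
  have sP: "s x \<subseteq> prod_space X {2..N}" if "x \<in> mspace (X 1)" for x
    using s that unfolding class_S_def by blast
  have "AE x in \<mu> 1. is_singleton (s x) \<and> x \<in> space (\<mu> 1)"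
    using s unfolding class_S_def by (auto simp: AE_space)
  then show single: "AE x in \<mu> 1. s x = {u x}"
  proof eventually_elim
    case (elim x)
    then have "u x \<in> s x" using u space_\<mu>[OF one_in] by simp
    then show ?case using elim by (auto simp: is_singleton_def)
  qed
  have "(\<lambda>x. u x j) \<in> M1 \<rightarrow>\<^sub>M \<mu> j \<and> distr M1 (\<mu> j) (\<lambda>x. u x j) = \<mu> j" if j: "j \<in> {2..N}" for j
  proof -
    have j1: "j \<in> {1..N}" using j by auto
    define W where "W = (\<lambda>E. multi_preimage (space (\<mu> 1)) (\<lambda>x. (\<lambda>z. z j) ` s x) E)"
    have W: "W E \<in> sets M1" "emeasure M1 (W E) = emeasure (\<mu> j) E" if "E \<in> sets (\<mu> j)" for E
      using s j that unfolding class_S_def measure_preserving_def W_def by blast+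
    have W_AE: "AE x in M1. (x \<in> W E) = (x \<in> (\<lambda>x. u x j) -` E \<inter> space M1)" for E
      using AE_completion[OF single]
      by eventually_elim (auto simp: W_def multi_preimage_def)
    have pre: "(\<lambda>x. u x j) -` E \<inter> space M1 \<in> sets M1" if "E \<in> sets (\<mu> j)" for E
      by (rule completion.in_sets_AE[OF W_AE[of E] W(1)[OF that]]) auto
    have meas: "(\<lambda>x. u x j) \<in> M1 \<rightarrow>\<^sub>M \<mu> j"
    proof (rule measurableI)
      fix x assume "x \<in> space M1"
      then have "u x \<in> prod_space X {2..N}" using u sP unfolding space_M1 by blast
      then show "u x j \<in> space (\<mu> j)"
        using prod_space_coordinate[OF _ j] unfolding space_\<mu>[OF j1] by blast
    qed (rule pre)
    moreover have "distr M1 (\<mu> j) (\<lambda>x. u x j) = \<mu> j"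
    proof (rule measure_eqI)
      fix E assume "E \<in> sets (distr M1 (\<mu> j) (\<lambda>x. u x j))"
      then have E: "E \<in> sets (\<mu> j)" by simp
      have "emeasure (distr M1 (\<mu> j) (\<lambda>x. u x j)) E = emeasure M1 ((\<lambda>x. u x j) -` E \<inter> space M1)"
        by (rule emeasure_distr[OF meas E])
      also have "\<dots> = emeasure M1 (W E)"
        using W_AE[of E] by (intro emeasure_eq_AE W(1)[OF E] pre[OF E]) (auto elim: AE_mp)
      finally show "emeasure (distr M1 (\<mu> j) (\<lambda>x. u x j)) E = emeasure (\<mu> j) E"
        by (simp only: W(2)[OF E])
    qed simp
    ultimately show ?thesis by blast
  qed
  then show "transport_map u" using u sP unfolding transport_map_def by blast
qed

lemma transport_map_class_S:
  assumes t: "transport_map t"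
  shows "(\<lambda>x. {t x}) \<in> class_S N X \<mu>"
proof -
  have "measure_preserving (\<mu> 1) (\<mu> j) (\<lambda>x. (\<lambda>z. z j) ` {t x})" if j: "j \<in> {2..N}" for j
    unfolding measure_preserving_def
  proof (intro ballI)
    fix E assume E: "E \<in> sets (\<mu> j)"
    have m: "(\<lambda>x. t x j) \<in> M1 \<rightarrow>\<^sub>M \<mu> j" "distr M1 (\<mu> j) (\<lambda>x. t x j) = \<mu> j"
      using t j unfolding transport_map_def by auto
    have "multi_preimage (space (\<mu> 1)) (\<lambda>x. (\<lambda>z. z j) ` {t x}) E = (\<lambda>x. t x j) -` E \<inter> space M1"
      by (auto simp: multi_preimage_def)
    then show "multi_preimage (space (\<mu> 1)) (\<lambda>x. (\<lambda>z. z j) ` {t x}) E \<in> sets M1 \<and>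
        emeasure M1 (multi_preimage (space (\<mu> 1)) (\<lambda>x. (\<lambda>z. z j) ` {t x}) E) = emeasure (\<mu> j) E"
      using measurable_sets[OF m(1) E] emeasure_distr[OF m(1) E] m(2) by simp
  qed
  then show ?thesis using t unfolding class_S_def transport_map_def by auto
qed

lemma transport_cost_selector:
  assumes u: "transport_map u" and eq: "AE x in \<mu> 1. s x = {u x}"
  shows "transport_cost c (\<mu> 1) s = (LINT x|M1. c ((u x)(1 := x)))"
proof -
  have AE: "AE x in M1. c ((u x)(1 := x)) = c ((the_elem (s x))(1 := x))"
    using AE_completion[OF eq] by eventually_elim simp
  note meas = borel_measurable_integrable[OF transport_map_cost_integrable[OF u]]
  show ?thesis
    unfolding transport_cost_def
    by (rule integral_cong_AE[symmetric, OF meas completion.measurable_AE_eq[OF meas AE] AE]) simp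
qed

text \<open>
  The common map is a selector of the c-normal sets of a dual maximizer. It belongs to the class and
  costs exactly the dual value, so every minimizer has zero duality gap.
\<close>

lemma minimizers_follow_one_map:
  assumes SV: "condition_SV N X c (\<mu> 1)"
  obtains t where "\<And>s. minimizer N X \<mu> c s \<Longrightarrow> AE x in \<mu> 1. s x = {t x}"
proof -
  obtain f where f: "potentials f" "c_conjugate N X c f"
      and max: "\<And>g. potentials g \<Longrightarrow> admissible g \<Longrightarrow> dual_value g \<le> dual_value f"
    by (rule dual_maximizer) blast
  have adm: "admissible f" by (rule conjugate_admissible[OF f])
  define t where "t = (\<lambda>x. SOME z. z \<in> c_normal N X c f x)"
  have t: "t x \<in> c_normal N X c f x" if "x \<in> mspace (X 1)" for x
    unfolding t_def using c_normal_nonempty[OF f that] by (simp add: some_in_eq)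
  have "AE x in \<mu> 1. is_singleton (c_normal N X c f x) \<and> x \<in> space (\<mu> 1)"
    using SV f unfolding condition_SV_def potentials_def by (auto simp: AE_space)
  then have single: "AE x in \<mu> 1. c_normal N X c f x = {t x}"
  proof eventually_elim
    case (elim x)
    then have "t x \<in> c_normal N X c f x" using t space_\<mu>[OF one_in] by simp
    then show ?case using elim by (auto simp: is_singleton_def)
  qed
  have tm: "transport_map t" by (rule c_normal_transport_map[OF f max t single])
  have "(LINT x|M1. c ((t x)(1 := x))) = (LINT x|M1. f 1 x + (\<Sum>k=2..N. f k (t x k)))"
    using t space_M1 by (intro Bochner_Integration.integral_cong) (auto simp: c_normal_def)
  then have cost_t: "transport_cost c (\<mu> 1) (\<lambda>x. {t x}) = dual_value f"
    using transport_cost_selector[OF tm, of "\<lambda>x. {t x}"] transport_map_potential_integral(2)[OF tm f(1)]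
    by simp
  have "AE x in \<mu> 1. s x = {t x}" if s: "minimizer N X \<mu> c s" for s
  proof -
    define u where "u = (\<lambda>x. SOME z. z \<in> s x)"
    have sS: "s \<in> class_S N X \<mu>" using s unfolding minimizer_def by blast
    have u: "u x \<in> s x" if "x \<in> mspace (X 1)" for x
      using sS that unfolding class_S_def u_def by (simp add: some_in_eq)
    have um: "transport_map u" "AE x in \<mu> 1. s x = {u x}"
      using class_S_selector[OF sS, of u] u by blast+
    have "transport_cost c (\<mu> 1) s \<le> dual_value f"
      using s transport_map_class_S[OF tm] unfolding minimizer_def cost_t[symmetric] by blast
    then have "(LINT x|M1. c ((u x)(1 := x))) \<le> dual_value f"
      by (simp only: transport_cost_selector[OF um])
    then have "AE x in M1. u x \<in> c_normal N X c f x"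
      by (rule zero_gap_in_c_normal[OF um(1) f(1) adm])
    then have "AE x in \<mu> 1. u x \<in> c_normal N X c f x" by (simp add: AE_completion_iff)
    then show ?thesis using um(2) single by eventually_elim auto
  qed
  then show thesis by (rule that)
qed

end

theorem theorem4p2:
  fixes N :: nat
    and X :: "nat \<Rightarrow> 'a metric"
    and \<mu> :: "nat \<Rightarrow> 'a measure"
    and c :: "(nat \<Rightarrow> 'a) \<Rightarrow> real"
    and s s' :: "'a \<Rightarrow> (nat \<Rightarrow> 'a) set"
  assumes "N \<ge> 2"
    and "\<And>j. j \<in> {1..N} \<Longrightarrow> mspace (X j) \<noteq> {}"
    and "\<And>j. j \<in> {1..N} \<Longrightarrow> compact_space (mtopology_of (X j))"
    and "\<And>j. j \<in> {1..N} \<Longrightarrow> finite_measure (\<mu> j)"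
    and "\<And>j. j \<in> {1..N} \<Longrightarrow> sets (\<mu> j) = sets (borel_of (mtopology_of (X j)))"
    and "\<And>j. j \<in> {2..N} \<Longrightarrow> emeasure (\<mu> 1) (mspace (X 1)) = emeasure (\<mu> j) (mspace (X j))"
    and "lipschitz_cost N X c"
    and "\<And>G. openin (mtopology_of (X 1)) G \<Longrightarrow> G \<noteq> {} \<Longrightarrow> emeasure (\<mu> 1) G > 0"
    and "condition_SV N X c (\<mu> 1)"
    and "minimizer N X \<mu> c s"
    and "minimizer N X \<mu> c s'"
  shows "AE x in \<mu> 1. s x = s' x"
proof -
  obtain K where K: "K > 0" "\<And>x y. x \<in> prod_space X {1..N} \<Longrightarrow> y \<in> prod_space X {1..N} \<Longrightarrow>
      \<bar>c x - c y\<bar> \<le> K * (\<Sum>i=1..N. mdist (X i) (x i) (y i))"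
    using assms(7) unfolding lipschitz_cost_def by blast
  interpret transport_problem N X c K \<mu>
  proof (intro transport_problem.intro compact_lipschitz_cost.intro transport_problem_axioms.intro)
    show "2 \<le> N" by (rule assms(1))
    fix j
    show "j \<in> {1..N} \<Longrightarrow> mspace (X j) \<noteq> {}" by (rule assms(2))
    show "j \<in> {1..N} \<Longrightarrow> compact_space (mtopology_of (X j))" by (rule assms(3))
    show "j \<in> {1..N} \<Longrightarrow> finite_measure (\<mu> j)" by (rule assms(4))
    show "j \<in> {1..N} \<Longrightarrow> sets (\<mu> j) = sets (borel_of (mtopology_of (X j)))" by (rule assms(5))
    show "j \<in> {2..N} \<Longrightarrow> emeasure (\<mu> 1) (mspace (X 1)) = emeasure (\<mu> j) (mspace (X j))"
      by (rule assms(6))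
  qed (rule K)+
  obtain t where t: "\<And>s. minimizer N X \<mu> c s \<Longrightarrow> AE x in \<mu> 1. s x = {t x}"
    by (rule minimizers_follow_one_map[OF assms(9)]) blast
  show ?thesis
    using t[OF assms(10)] t[OF assms(11)] by eventually_elim simp
qed

end
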